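(* Let $X\subseteq\mathbb{P}^{N-1}$ (over $\mathbb{C}$) be a nondegenerate irreducible curve, and identify $X$ with its affine cone in $\mathbb{A}^N$. Then for every $s\ge 1$, $M(X^{\{s\}}) = sM(X)$. In particular, $M(X^{\{s\}})$ is the uniform matroid of rank $\min\{2s,N\}$ on $Z=\{z_1,\ldots,z_N\}$.
   Context: Nondegenerate means $X$ is not contained in any hyperplane. For an irreducible affine cone $X\subseteq\mathbb{A}^N$, the $s$-th secant variety is the join $X^{\{s\}}=\overline{\{x_1+\cdots+x_s: x_i\in X\}}$. The algebraic matroid $M(Y)$ of an irreducible variety $Y\subseteq\mathbb{A}^N$ is the matroid on $Z=\{z_1,\ldots,z_N\}$ in which $E\subseteq Z$ is independent iff $\mathcal{I}(Y)\cap\mathbb{C}[E]=\langle0\rangle$. $sM$ denotes the $s$-fold matroid union $M\vee\cdots\vee M$, whose independent sets are unions of $s$ independent sets of $M$. *)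

theory Defs
  imports "HOL-Analysis.Analysis" "HOL-Library.Poly_Mapping" "HOL-Library.Extended_Nat"
begin

section \<open>Polynomials over the complex numbers\<close>

text \<open>A monomial is a finitely supported exponent function. The ring structure on this type is
  the convolution product of \<^theory>\<open>HOL-Library.Poly_Mapping\<close>.\<close>

type_synonym 'v cpoly = "('v \<Rightarrow>\<^sub>0 nat) \<Rightarrow>\<^sub>0 complex"

definition peval :: "'v cpoly \<Rightarrow> ('v \<Rightarrow> complex) \<Rightarrow> complex" where
  "peval p x = (\<Sum>m\<in>Poly_Mapping.keys p.
      Poly_Mapping.lookup p m * (\<Prod>i\<in>Poly_Mapping.keys m. x i ^ Poly_Mapping.lookup m i))"

text \<open>The subring of polynomials involving only the variables in \<open>E\<close>.\<close>

definition polys_in :: "'v set \<Rightarrow> 'v cpoly set" where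
  "polys_in E = {p. \<forall>m\<in>Poly_Mapping.keys p. Poly_Mapping.keys m \<subseteq> E}"

definition homogeneous :: "nat \<Rightarrow> 'v cpoly \<Rightarrow> bool" where
  "homogeneous d p \<longleftrightarrow>
     (\<forall>m\<in>Poly_Mapping.keys p. (\<Sum>i\<in>Poly_Mapping.keys m. Poly_Mapping.lookup m i) = d)"


section \<open>Affine space\<close>

definition vanishing_ideal :: "(complex ^ 'n) set \<Rightarrow> 'n cpoly set" where
  "vanishing_ideal Y = {p. \<forall>y\<in>Y. peval p (($) y) = 0}"

definition zariski_closed :: "(complex ^ 'n) set \<Rightarrow> bool" where
  "zariski_closed Y \<longleftrightarrow> (\<exists>S :: 'n cpoly set. Y = {y. \<forall>p\<in>S. peval p (($) y) = 0})"

text \<open>The \<open>s\<close>-th secant variety of an affine cone; \<open>hull\<close> yields the Zariski closure.\<close>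

definition secant_variety :: "nat \<Rightarrow> (complex ^ 'n) set \<Rightarrow> (complex ^ 'n) set" where
  "secant_variety s Y =
     zariski_closed hull {(\<Sum>i<s. x i) | x :: nat \<Rightarrow> complex ^ 'n. \<forall>i<s. x i \<in> Y}"


section \<open>Projective varieties\<close>

text \<open>A point of projective space is a line through the origin, taken as a set of vectors.\<close>

definition proj_space :: "(complex ^ 'n) set set" where
  "proj_space = {range (\<lambda>c. c *s v) | v. v \<noteq> 0}"

definition proj_closed :: "(complex ^ 'n) set set \<Rightarrow> bool" where
  "proj_closed X \<longleftrightarrow> (\<exists>S :: 'n cpoly set. (\<forall>p\<in>S. \<exists>d. homogeneous d p) \<and>
     X = {L \<in> proj_space. \<forall>p\<in>S. \<forall>v\<in>L. peval p (($) v) = 0})"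

definition irreducible_proj_variety :: "(complex ^ 'n) set set \<Rightarrow> bool" where
  "irreducible_proj_variety X \<longleftrightarrow> proj_closed X \<and> X \<noteq> {} \<and>
     (\<forall>A B. proj_closed A \<and> proj_closed B \<and> X \<subseteq> A \<union> B \<longrightarrow> X \<subseteq> A \<or> X \<subseteq> B)"

definition affine_cone :: "(complex ^ 'n) set set \<Rightarrow> (complex ^ 'n) set" where
  "affine_cone X = insert 0 (\<Union>X)"

definition proj_hyperplane :: "(complex ^ 'n) set set \<Rightarrow> bool" where
  "proj_hyperplane H \<longleftrightarrow> (\<exists>a :: complex ^ 'n. a \<noteq> 0 \<and>
     H = {L \<in> proj_space. \<forall>v\<in>L. (\<Sum>i\<in>UNIV. a $ i * v $ i) = 0})"

definition nondegenerate :: "(complex ^ 'n) set set \<Rightarrow> bool" where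
  "nondegenerate X \<longleftrightarrow> \<not> (\<exists>H. proj_hyperplane H \<and> X \<subseteq> H)"

text \<open>The dimension of an irreducible projective variety is the transcendence degree over the
  complex numbers of its function field. An element of the function field is a fraction of two
  forms of equal degree whose denominator does not vanish identically on \<open>X\<close>, and finitely many
  such fractions can be written as \<open>f 0 / g, \<dots>, f (k - 1) / g\<close> with a common
  denominator. As \<open>X\<close> is irreducible, a polynomial expression in them is the zero element exactly
  when it vanishes at every point of \<open>X\<close> with \<open>g \<noteq> 0\<close>.\<close>

definition alg_indep_rational_functions ::
    "(complex ^ 'n) set set \<Rightarrow> nat \<Rightarrow> (nat \<Rightarrow> 'n cpoly) \<Rightarrow> 'n cpoly \<Rightarrow> bool" where
  "alg_indep_rational_functions X k f g \<longleftrightarrow>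
     (\<exists>d. homogeneous d g \<and> (\<forall>j<k. homogeneous d (f j))) \<and>
     g \<notin> vanishing_ideal (affine_cone X) \<and>
     (\<forall>P\<in>polys_in {..<k}.
        (\<forall>v\<in>affine_cone X. peval g (($) v) \<noteq> 0 \<longrightarrow>
            peval P (\<lambda>j. peval (f j) (($) v) / peval g (($) v)) = 0)
        \<longrightarrow> P = 0)"

definition proj_dim :: "(complex ^ 'n) set set \<Rightarrow> enat" where
  "proj_dim X = Sup {enat k | k. \<exists>f g. alg_indep_rational_functions X k f g}"

definition irreducible_proj_curve :: "(complex ^ 'n) set set \<Rightarrow> bool" where
  "irreducible_proj_curve X \<longleftrightarrow> irreducible_proj_variety X \<and> proj_dim X = 1"


section \<open>Matroids\<close>

text \<open>All matroids here have as ground set the set of coordinates, indexed by a finite type, and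
  are given by their family of independent sets.\<close>

definition alg_matroid :: "(complex ^ 'n) set \<Rightarrow> 'n set set" where
  "alg_matroid Y = {E. vanishing_ideal Y \<inter> polys_in E = {0}}"

definition matroid_union_power :: "nat \<Rightarrow> 'a set set \<Rightarrow> 'a set set" where
  "matroid_union_power s M = {(\<Union>i<s. I i) | I :: nat \<Rightarrow> 'a set. \<forall>i<s. I i \<in> M}"

definition uniform_matroid :: "nat \<Rightarrow> 'a::finite set set" where
  "uniform_matroid r = {E. card E \<le> r}"

end

theory Submission
  imports Defs "HOL-Computational_Algebra.Polynomial"
begin

text \<open>A curve has, besides the scaling of its cone, one further parameter, so a sum of \<open>s\<close> points of
  the cone depends on \<open>2s\<close> parameters; counting monomials of large degree shows that any \<open>2s + 1\<close>
  coordinates of such a sum are algebraically dependent.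

  Conversely, let \<open>Q\<close> be a nonzero polynomial of least degree in at most \<open>2s\<close> coordinates that vanishes
  on all sums \<open>y\<^sub>1 + \<dots> + y\<^sub>s\<close>. By minimality its gradient is nonzero at a generic sum, and the gradient is
  orthogonal to every \<open>y\<^sub>i\<close> and to every tangent direction \<open>w(y\<^sub>i)\<close>. The field \<open>w\<close> comes from the derivation
  extending \<open>d/dx\<close> for a nonconstant coordinate \<open>x\<close>. In characteristic \<open>0\<close>, a quotient of two linear forms
  with zero derivative along \<open>w\<close> is constant on the curve, which nondegeneracy excludes for independent
  forms; hence each generic point lowers the dimension of the space of possible gradients by two, and
  nothing is left after \<open>s\<close> points.

  The matroid of the cone itself is the case \<open>s = 1\<close>, and the \<open>s\<close>-fold union of the uniform matroid of
  rank \<open>2\<close> is uniform.\<close>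

section \<open>Polynomial functions\<close>

text \<open>The obstacle is the tangency of \<open>w\<close>. The field is built to annihilate one
  relation per coordinate, \<open>P i\<close> in \<open>v $ k\<close> and \<open>v $ i\<close>.
  These relations may cut out more than the curve and generate an ideal that is not radical, so
  annihilating them does not by itself make \<open>w\<close> annihilate every polynomial vanishing
  on the curve. The bridge is a multiple \<open>G * F ^ m\<close> in the ideal with \<open>G\<close>
  not identically zero on the curve; differentiation then removes the powers of \<open>F\<close>.
  That multiple and the count for sums rest on the same reduction: modulo the relations, and up to a
  power of their leading coefficients, polynomials of degree at most \<open>d\<close> lie in an
  explicit span whose size is linear in \<open>d\<close>. The work is done on an affine chart, where
  any two rational functions are algebraically dependent; the scaling of the cone becomes a separate
  scalar. The least-degree argument is run as an induction on a degree bound, so \<open>pf\<close>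
  records this bound and the set of variables.\<close>

inductive pf :: "'n set \<Rightarrow> nat \<Rightarrow> (complex ^ 'n \<Rightarrow> complex) \<Rightarrow> bool" for E where
  pf_const: "pf E d (\<lambda>_. c)"
| pf_add: "pf E d f \<Longrightarrow> pf E d g \<Longrightarrow> pf E d (\<lambda>v. f v + g v)"
| pf_coord: "pf E d f \<Longrightarrow> i \<in> E \<Longrightarrow> pf E (Suc d) (\<lambda>v. v $ i * f v)"

definition polyf :: "(complex ^ 'n \<Rightarrow> complex) \<Rightarrow> bool" where
  "polyf f \<longleftrightarrow> (\<exists>d. pf UNIV d f)"

lemma pf_Suc: "pf E d f \<Longrightarrow> pf E (Suc d) f"
  by (induction rule: pf.induct) (auto intro: pf.intros)

lemma pf_mono: "pf E d f \<Longrightarrow> d \<le> d' \<Longrightarrow> pf E d' f"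
  by (rotate_tac, induction d' rule: dec_induct) (auto intro: pf_Suc)

lemma pf_mono_vars: "pf E d f \<Longrightarrow> E \<subseteq> E' \<Longrightarrow> pf E' d f"
  by (induction rule: pf.induct) (auto intro: pf.intros)

lemma pf_var: "i \<in> E \<Longrightarrow> pf E (Suc d) (\<lambda>v. v $ i)"
  using pf_coord[OF pf_const[of E d 1], of i] by simp

lemma pf_cmult: "pf E d f \<Longrightarrow> pf E d (\<lambda>v. c * f v)"
proof (induction rule: pf.induct)
  case (pf_coord d f i)
  have "pf E (Suc d) (\<lambda>v. v $ i * (c * f v))"
    by (rule pf.pf_coord[OF pf_coord.IH pf_coord.hyps(2)])
  then show ?case by (simp add: mult.left_commute)
qed (auto intro: pf.intros simp: distrib_left)

lemma pf_mult: "pf E d f \<Longrightarrow> pf E d' g \<Longrightarrow> pf E (d + d') (\<lambda>v. f v * g v)"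
proof (induction rule: pf.induct)
  case (pf_const d c)
  then show ?case by (intro pf_cmult) (auto intro: pf_mono)
next
  case (pf_add d f g)
  then show ?case by (simp add: distrib_right pf.pf_add)
next
  case (pf_coord d f i)
  then show ?case using pf.pf_coord[of E "d + d'" "\<lambda>v. f v * g v" i] by (simp add: mult.assoc)
qed

lemma pf_power: "pf E d f \<Longrightarrow> pf E (k * d) (\<lambda>v. f v ^ k)"
  by (induction k) (auto intro: pf_const pf_mult)

lemma pf_prod:
  "finite I \<Longrightarrow> (\<And>i. i \<in> I \<Longrightarrow> pf E (d i) (f i)) \<Longrightarrow> pf E (\<Sum>i\<in>I. d i) (\<lambda>v. \<Prod>i\<in>I. f i v)"
  by (induction I rule: finite_induct) (auto intro: pf_const pf_mult)

lemma pf_imp_polyf: "pf E d f \<Longrightarrow> polyf f"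
  unfolding polyf_def using pf_mono_vars[OF _ subset_UNIV] by blast

lemma polyf_const [simp]: "polyf (\<lambda>_. c)"
  by (rule pf_imp_polyf[OF pf_const[of UNIV 0]])

lemma polyf_var [simp]: "polyf (\<lambda>v. v $ i)"
  by (rule pf_imp_polyf[OF pf_var[OF UNIV_I]])

lemma polyf_add:
  assumes "polyf f" "polyf g"
  shows "polyf (\<lambda>v. f v + g v)"
proof -
  obtain d d' where "pf UNIV d f" "pf UNIV d' g" using assms by (auto simp: polyf_def)
  then have "pf UNIV (max d d') f" "pf UNIV (max d d') g" by (auto elim: pf_mono)
  then show ?thesis by (rule pf_imp_polyf[OF pf_add])
qed

lemma polyf_mult:
  assumes "polyf f" "polyf g"
  shows "polyf (\<lambda>v. f v * g v)"
proof -
  obtain d d' where "pf UNIV d f" "pf UNIV d' g" using assms by (auto simp: polyf_def)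
  then show ?thesis by (rule pf_imp_polyf[OF pf_mult])
qed

lemma polyf_minus: "polyf f \<Longrightarrow> polyf (\<lambda>v. - f v)"
  using polyf_mult[OF polyf_const[of "-1"], of f] by simp

lemma polyf_diff: "polyf f \<Longrightarrow> polyf g \<Longrightarrow> polyf (\<lambda>v. f v - g v)"
  using polyf_add[OF _ polyf_minus, of f g] by simp

lemma polyf_power: "polyf f \<Longrightarrow> polyf (\<lambda>v. f v ^ k)"
  by (induction k) (simp_all add: polyf_mult)

lemma polyf_sum: "(\<And>i. i \<in> I \<Longrightarrow> polyf (f i)) \<Longrightarrow> polyf (\<lambda>v. \<Sum>i\<in>I. f i v)"
  by (induction I rule: infinite_finite_induct) (simp_all add: polyf_add)

lemma polyf_prod: "(\<And>i. i \<in> I \<Longrightarrow> polyf (f i)) \<Longrightarrow> polyf (\<lambda>v. \<Prod>i\<in>I. f i v)"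
  by (induction I rule: infinite_finite_induct) (simp_all add: polyf_mult)

lemmas polyf_intros = polyf_const polyf_var polyf_minus polyf_diff polyf_add polyf_mult polyf_power polyf_sum polyf_prod

lemma polyf_induct [consumes 1, case_names const add coord]:
  assumes "polyf f"
    and "\<And>c. P (\<lambda>_. c)"
    and "\<And>f g. polyf f \<Longrightarrow> P f \<Longrightarrow> polyf g \<Longrightarrow> P g \<Longrightarrow> P (\<lambda>v. f v + g v)"
    and "\<And>f i. polyf f \<Longrightarrow> P f \<Longrightarrow> P (\<lambda>v. v $ i * f v)"
  shows "P f"
proof -
  obtain d where "pf UNIV d f" using assms(1) polyf_def by blast
  then show ?thesis
    by (induction rule: pf.induct) (auto intro!: assms(2-) dest: pf_imp_polyf)
qed

lemma polyf_compose:
  assumes "polyf f" "\<And>i. polyf (\<lambda>v. h v $ i)"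
  shows "polyf (\<lambda>v. f (h v))"
  using assms(1) by (induction rule: polyf_induct) (simp_all add: polyf_add polyf_mult assms(2))

lemma polyf_poly: "polyf f \<Longrightarrow> polyf (\<lambda>v. poly c (f v))"
  by (induction c) (simp_all add: polyf_add polyf_mult)

section \<open>Bivariate polynomials\<close>

text \<open>The outer variable takes the value \<open>b\<close> and the coefficients are evaluated
  at \<open>a\<close>. Hence \<open>degree\<close> and \<open>pderiv\<close> refer to
  \<open>b\<close>, while \<open>map_poly pderiv\<close> differentiates in \<open>a\<close>.\<close>

definition ev :: "complex poly poly \<Rightarrow> complex \<Rightarrow> complex \<Rightarrow> complex" where
  "ev P a b = poly (poly P [:b:]) a"

lemma ev_0 [simp]: "ev 0 a b = 0"
  and ev_pCons [simp]: "ev (pCons c P) a b = poly c a + b * ev P a b"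
  and ev_1 [simp]: "ev 1 a b = 1"
  and ev_add [simp]: "ev (P + Q) a b = ev P a b + ev Q a b"
  by (simp_all add: ev_def)

lemma ev_altdef: "ev P a b = (\<Sum>k\<le>degree P. poly (coeff P k) a * b ^ k)"
  unfolding ev_def poly_altdef[of P] by (simp add: poly_sum poly_power)

lemma polyf_ev: "polyf f \<Longrightarrow> polyf g \<Longrightarrow> polyf (\<lambda>v. ev P (f v) (g v))"
  by (induction P) (simp_all add: polyf_add polyf_mult polyf_poly)

lemma ev_field_derivative:
  assumes "(f has_field_derivative f') (at t)" "(g has_field_derivative g') (at t)"
  shows "((\<lambda>t. ev P (f t) (g t)) has_field_derivative
           ev (map_poly pderiv P) (f t) (g t) * f' + ev (pderiv P) (f t) (g t) * g') (at t)"
proof (induction P)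
  case (pCons c P)
  have "((\<lambda>t. poly c (f t)) has_field_derivative poly (pderiv c) (f t) * f') (at t)"
    using DERIV_chain2[OF poly_DERIV assms(1)] .
  from DERIV_add[OF this DERIV_mult[OF assms(2) pCons.IH]]
  show ?case unfolding ev_pCons
    by (rule DERIV_cong) (simp add: pderiv_pCons map_poly_pCons algebra_simps)
qed simp

section \<open>Directional derivatives\<close>

definition DD :: "(complex ^ 'n \<Rightarrow> complex) \<Rightarrow> complex ^ 'n \<Rightarrow> complex ^ 'n \<Rightarrow> complex" where
  "DD f v h = deriv (\<lambda>t. f (v + t *s h)) 0"

lemma DD_eqI: "((\<lambda>t. f (v + t *s h)) has_field_derivative c) (at 0) \<Longrightarrow> DD f v h = c"
  unfolding DD_def by (rule DERIV_imp_deriv)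

text \<open>The lower degree bound drives the induction in \<open>independent_sums\<close>, and the
  vanishing outside \<open>E\<close> confines gradients to a space of dimension at most
  \<open>card E\<close>. As \<open>0 - 1 = 0\<close> on naturals, degree 0 is singled out to force a
  zero gradient.\<close>

lemma pf_gradient:
  assumes "pf E d f"
  shows "\<exists>g. (\<forall>i. if d = 0 then g i = (\<lambda>_. 0) else pf E (d - 1) (g i)) \<and> (\<forall>i. i \<notin> E \<longrightarrow> g i = (\<lambda>_. 0)) \<and>
    (\<forall>v h t. ((\<lambda>t. f (v + t *s h)) has_field_derivative (\<Sum>i\<in>UNIV. g i (v + t *s h) * h $ i)) (at t))"
  using assms
proof (induction rule: pf.induct)
  case (pf_const d c)
  show ?case by (rule exI[of _ "\<lambda>_ _. 0"]) (auto intro: pf.pf_const)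
next
  case (pf_add d f g)
  from pf_add.IH obtain F G where
    F: "\<forall>i. if d = 0 then F i = (\<lambda>_. 0) else pf E (d - 1) (F i)" "\<forall>i. i \<notin> E \<longrightarrow> F i = (\<lambda>_. 0)"
    "\<And>v h t. ((\<lambda>t. f (v + t *s h)) has_field_derivative (\<Sum>i\<in>UNIV. F i (v + t *s h) * h $ i)) (at t)" and
    G: "\<forall>i. if d = 0 then G i = (\<lambda>_. 0) else pf E (d - 1) (G i)" "\<forall>i. i \<notin> E \<longrightarrow> G i = (\<lambda>_. 0)"
    "\<And>v h t. ((\<lambda>t. g (v + t *s h)) has_field_derivative (\<Sum>i\<in>UNIV. G i (v + t *s h) * h $ i)) (at t)"
    by blast
  show ?case
    apply (rule exI[of _ "\<lambda>i v. F i v + G i v"])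
    using F(1,2) G(1,2) DERIV_add[OF F(3) G(3)]
    by (auto intro: pf.pf_add simp: distrib_right sum.distrib)
next
  case (pf_coord d f l)
  from pf_coord.IH obtain F where
    F: "\<forall>i. if d = 0 then F i = (\<lambda>_. 0) else pf E (d - 1) (F i)" "\<forall>i. i \<notin> E \<longrightarrow> F i = (\<lambda>_. 0)"
    "\<And>v h t. ((\<lambda>t. f (v + t *s h)) has_field_derivative (\<Sum>i\<in>UNIV. F i (v + t *s h) * h $ i)) (at t)"
    by blast
  define G where "G = (\<lambda>i v. (v::complex^'a) $ l * F i v + (if i = l then f v else 0))"
  have G1: "pf E d (G i)" for i
  proof (cases d)
    case 0
    then have "G i = (\<lambda>v. if i = l then f v else 0)" using F(1) by (auto simp: G_def)
    then show ?thesis using pf_coord.hyps by (cases "i = l") (auto intro: pf.pf_const)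
  next
    case (Suc d')
    then have "pf E d (\<lambda>v. v $ l * F i v)" using F(1) pf_coord.hyps pf.pf_coord[of E d' "F i" l] by auto
    moreover have "pf E d (\<lambda>v. if i = l then f v else 0)"
      using pf_coord.hyps by (cases "i = l") (auto intro: pf.pf_const)
    ultimately show ?thesis unfolding G_def by (rule pf.pf_add)
  qed
  have G3: "((\<lambda>t. (v + t *s h) $ l * f (v + t *s h)) has_field_derivative (\<Sum>i\<in>UNIV. G i (v + t *s h) * h $ i)) (at t)"
    for v h t
  proof -
    have "((\<lambda>t. (v + t *s h) $ l) has_field_derivative h $ l) (at t)"
      by (auto intro!: derivative_eq_intros)
    from DERIV_mult[OF this F(3)[of v h t]] show ?thesis
    proof (rule DERIV_cong)
      have "(\<Sum>i\<in>UNIV. (if i = l then f (v + t *s h) else 0) * h $ i) = f (v + t *s h) * h $ l"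
        by (simp add: if_distrib[of "\<lambda>x. x * _"] cong: if_cong)
      then show "h $ l * f (v + t *s h) + (\<Sum>i\<in>UNIV. F i (v + t *s h) * h $ i) * (v + t *s h) $ l
          = (\<Sum>i\<in>UNIV. G i (v + t *s h) * h $ i)"
        unfolding G_def distrib_right sum.distrib by (simp add: sum_distrib_left mult_ac)
    qed
  qed
  have "\<forall>i. i \<notin> E \<longrightarrow> G i = (\<lambda>_. 0)" using F(2) pf_coord.hyps by (auto simp: G_def)
  with G1 G3 show ?case by (intro exI[of _ G]) auto
qed

lemma polyf_gradient:
  assumes "polyf f"
  shows "\<exists>g. (\<forall>i. polyf (g i)) \<and> (\<forall>v h. DD f v h = (\<Sum>i\<in>UNIV. g i v * h $ i))"
proof -
  obtain d where "pf UNIV d f" using assms polyf_def by blast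
  from pf_gradient[OF this] obtain g where
    g: "\<forall>i. if d = 0 then g i = (\<lambda>_. 0) else pf UNIV (d - 1) (g i)"
    "\<And>v h t. ((\<lambda>t. f (v + t *s h)) has_field_derivative (\<Sum>i\<in>UNIV. g i (v + t *s h) * h $ i)) (at t)"
    by blast
  have "polyf (g i)" for i using g(1)[rule_format, of i] pf_imp_polyf[of UNIV "d - 1" "g i"]
    by (cases "d = 0") simp_all
  moreover have "DD f v h = (\<Sum>i\<in>UNIV. g i v * h $ i)" for v h
    using DD_eqI[OF g(2)[of v h 0]] by simp
  ultimately show ?thesis by blast
qed

lemma DD_field_derivative:
  assumes "polyf f"
  shows "((\<lambda>t. f (v + t *s h)) has_field_derivative DD f v h) (at 0)"
proof -
  obtain d where "pf UNIV d f" using assms polyf_def by blast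
  from pf_gradient[OF this] obtain c where "((\<lambda>t. f (v + t *s h)) has_field_derivative c) (at 0)"
    by blast
  then show ?thesis using DD_eqI by metis
qed

lemma polyf_DD:
  assumes "polyf f" "\<And>i. polyf (\<lambda>v. w v $ i)"
  shows "polyf (\<lambda>v. DD f v (w v))"
proof -
  from polyf_gradient[OF assms(1)] obtain g where
    "\<forall>i. polyf (g i)" "\<forall>v h. DD f v h = (\<Sum>i\<in>UNIV. g i v * h $ i)" by blast
  with assms(2) show ?thesis by (simp add: polyf_sum polyf_mult)
qed

lemma DD_coord: "DD (\<lambda>v. v $ i) v h = h $ i"
  by (rule DD_eqI) (auto intro!: derivative_eq_intros)

lemma DD_add: "polyf f \<Longrightarrow> polyf g \<Longrightarrow> DD (\<lambda>v. f v + g v) v h = DD f v h + DD g v h"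
  by (intro DD_eqI DERIV_add DD_field_derivative)

lemma DD_mult:
  assumes "polyf f" "polyf g"
  shows "DD (\<lambda>v. f v * g v) v h = DD f v h * g v + f v * DD g v h"
  using DERIV_mult[OF DD_field_derivative DD_field_derivative, OF assms, of v h v h]
  by (intro DD_eqI) (simp add: mult.commute)

lemma DD_sum:
  "finite I \<Longrightarrow> (\<And>i. i \<in> I \<Longrightarrow> polyf (f i)) \<Longrightarrow> DD (\<lambda>v. \<Sum>i\<in>I. f i v) v h = (\<Sum>i\<in>I. DD (f i) v h)"
proof (induction I rule: finite_induct)
  case empty
  show ?case by (auto intro: DD_eqI)
next
  case (insert i I)
  then show ?case by (simp add: DD_add polyf_sum)
qed

lemma DD_power_Suc:
  assumes "polyf f"
  shows "DD (\<lambda>v. f v ^ Suc m) v h = of_nat (Suc m) * f v ^ m * DD f v h"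
  using DERIV_power[OF DD_field_derivative[OF assms], of v h "Suc m"]
  by (intro DD_eqI) (simp add: mult_ac)

lemma DD_ev:
  assumes "polyf f" "polyf g"
  shows "DD (\<lambda>v. ev P (f v) (g v)) v h =
    ev (map_poly pderiv P) (f v) (g v) * DD f v h + ev (pderiv P) (f v) (g v) * DD g v h"
  using ev_field_derivative[OF DD_field_derivative DD_field_derivative, OF assms, of P v h v h]
  by (intro DD_eqI) simp

section \<open>Polynomials and polynomial functions\<close>

definition mono_eval :: "('v \<Rightarrow>\<^sub>0 nat) \<Rightarrow> ('v \<Rightarrow> complex) \<Rightarrow> complex" where
  "mono_eval m x = (\<Prod>i\<in>Poly_Mapping.keys m. x i ^ Poly_Mapping.lookup m i)"

lemma peval_altdef: "peval p x = (\<Sum>m\<in>Poly_Mapping.keys p. Poly_Mapping.lookup p m * mono_eval m x)"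
  by (simp add: peval_def mono_eval_def)

lemma peval_superset:
  "finite K \<Longrightarrow> Poly_Mapping.keys p \<subseteq> K \<Longrightarrow> peval p x = (\<Sum>m\<in>K. Poly_Mapping.lookup p m * mono_eval m x)"
  unfolding peval_altdef by (rule sum.mono_neutral_left) (auto simp: in_keys_iff)

lemma mono_eval_superset:
  "finite K \<Longrightarrow> Poly_Mapping.keys m \<subseteq> K \<Longrightarrow> mono_eval m x = (\<Prod>i\<in>K. x i ^ Poly_Mapping.lookup m i)"
  unfolding mono_eval_def by (rule prod.mono_neutral_left) (auto simp: in_keys_iff)

lemma mono_eval_UNIV: "mono_eval m x = (\<Prod>i\<in>UNIV. x i ^ Poly_Mapping.lookup m i)" for m :: "'v::finite \<Rightarrow>\<^sub>0 nat"
  by (rule mono_eval_superset) auto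

lemma peval_0 [simp]: "peval 0 x = 0"
  by (simp add: peval_def)

lemma peval_add: "peval (p + q) x = peval p x + peval q x"
proof -
  let ?K = "Poly_Mapping.keys p \<union> Poly_Mapping.keys q"
  have "Poly_Mapping.keys (p + q) \<subseteq> ?K" by (rule keys_add)
  then show ?thesis
    by (simp add: peval_superset[of ?K] lookup_add distrib_right sum.distrib)
qed

lemma peval_sum: "peval (\<Sum>i\<in>I. p i) x = (\<Sum>i\<in>I. peval (p i) x)"
  by (induction I rule: infinite_finite_induct) (auto simp: peval_add)

lemma peval_single: "peval (Poly_Mapping.single m c) x = c * mono_eval m x"
  by (simp add: peval_altdef)

section \<open>Forms, homogenization and homogeneous components\<close>

lemma mono_eval_scale:
  fixes v :: "complex ^ 'n"
  shows "mono_eval m (($) (t *s v)) = t ^ (\<Sum>i\<in>Poly_Mapping.keys m. Poly_Mapping.lookup m i) * mono_eval m (($) v)"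
  by (simp add: mono_eval_def power_mult_distrib prod.distrib power_sum)

lemma peval_homogeneous:
  fixes v :: "complex ^ 'n"
  assumes "homogeneous d p"
  shows "peval p (($) (t *s v)) = t ^ d * peval p (($) v)"
  using assms unfolding peval_altdef sum_distrib_left
  by (intro sum.cong) (auto simp: mono_eval_scale homogeneous_def)

lemma homogeneous_add: "homogeneous d p \<Longrightarrow> homogeneous d q \<Longrightarrow> homogeneous d (p + q)"
  using keys_add[of p q] unfolding homogeneous_def by blast

lemma homogeneous_0 [simp]: "homogeneous d 0"
  by (simp add: homogeneous_def)

lemma homogeneous_sum: "(\<And>i. i \<in> I \<Longrightarrow> homogeneous d (p i)) \<Longrightarrow> homogeneous d (\<Sum>i\<in>I. p i)"
  by (induction I rule: infinite_finite_induct) (auto simp: homogeneous_add)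

lemma homogeneous_single:
  fixes m :: "'v::finite \<Rightarrow>\<^sub>0 nat"
  shows "(\<Sum>i\<in>UNIV. Poly_Mapping.lookup m i) = d \<Longrightarrow> homogeneous d (Poly_Mapping.single m c)"
proof -
  assume "(\<Sum>i\<in>UNIV. Poly_Mapping.lookup m i) = d"
  moreover have "(\<Sum>i\<in>Poly_Mapping.keys m. Poly_Mapping.lookup m i) = (\<Sum>i\<in>UNIV. Poly_Mapping.lookup m i)"
    by (rule sum.mono_neutral_left) (auto simp: in_keys_iff)
  ultimately show ?thesis by (simp add: homogeneous_def)
qed

lemma homogeneous_degree:
  fixes m :: "'v::finite \<Rightarrow>\<^sub>0 nat"
  assumes "homogeneous d p" "m \<in> Poly_Mapping.keys p"
  shows "(\<Sum>i\<in>UNIV. Poly_Mapping.lookup m i) = d"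
proof -
  have "(\<Sum>i\<in>Poly_Mapping.keys m. Poly_Mapping.lookup m i) = (\<Sum>i\<in>UNIV. Poly_Mapping.lookup m i)"
    by (rule sum.mono_neutral_left) (auto simp: in_keys_iff)
  then show ?thesis using assms by (simp add: homogeneous_def)
qed

lemma homogeneous_coord_mult:
  fixes p :: "'n::finite cpoly"
  assumes "homogeneous d p"
  shows "\<exists>q. homogeneous (Suc d) q \<and> (\<forall>x. peval q x = x i * peval p x)"
proof (intro exI conjI allI)
  let ?q = "\<Sum>m\<in>Poly_Mapping.keys p.
    Poly_Mapping.single (m + Poly_Mapping.single i 1) (Poly_Mapping.lookup p m)"
  show "homogeneous (Suc d) ?q"
    using homogeneous_degree[OF assms]
    by (intro homogeneous_sum homogeneous_single) (simp add: lookup_add sum.distrib lookup_single when_def)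
  show "peval ?q x = x i * peval p x" for x
  proof -
    have "mono_eval (m + Poly_Mapping.single i 1) x = x i * mono_eval m x" for m
    proof -
      have "(\<Prod>j\<in>UNIV. x j ^ Poly_Mapping.lookup (Poly_Mapping.single i (1::nat)) j) = (\<Prod>j\<in>UNIV. if i = j then x j else 1)"
        by (intro prod.cong) (auto simp: lookup_single when_def)
      then show ?thesis
        by (simp add: mono_eval_UNIV lookup_add power_add prod.distrib)
    qed
    then show ?thesis
      by (simp add: peval_sum peval_single peval_altdef[of p] sum_distrib_left mult_ac)
  qed
qed

text \<open>Missing degree is filled up with powers of \<open>v $ k\<close>. Since \<open>d\<close>
  is only a bound, several functions can be homogenized to one common degree.\<close>

lemma homogenize:
  fixes f :: "complex ^ 'n \<Rightarrow> complex"
  assumes "pf UNIV d f"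
  shows "\<exists>p. homogeneous d p \<and> (\<forall>v. v $ k \<noteq> 0 \<longrightarrow> peval p (($) v) = (v $ k) ^ d * f (inverse (v $ k) *s v))"
  using assms
proof (induction rule: pf.induct)
  case (pf_const d c)
  have "homogeneous d (Poly_Mapping.single (Poly_Mapping.single k d) c)"
    by (intro homogeneous_single) (simp add: lookup_single when_def)
  then show ?case by (auto simp: peval_single mono_eval_def mult.commute intro!: exI[of _ "Poly_Mapping.single (Poly_Mapping.single k d) c"])
next
  case (pf_add d f g)
  then obtain p q where
    "homogeneous d p" "\<forall>v. v $ k \<noteq> 0 \<longrightarrow> peval p (($) v) = (v $ k) ^ d * f (inverse (v $ k) *s v)"
    "homogeneous d q" "\<forall>v. v $ k \<noteq> 0 \<longrightarrow> peval q (($) v) = (v $ k) ^ d * g (inverse (v $ k) *s v)"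
    by blast
  then show ?case
    by (intro exI[of _ "p + q"]) (auto simp: homogeneous_add peval_add distrib_left)
next
  case (pf_coord d f i)
  then obtain p where p: "homogeneous d p"
    "\<forall>v. v $ k \<noteq> 0 \<longrightarrow> peval p (($) v) = (v $ k) ^ d * f (inverse (v $ k) *s v)" by blast
  from homogeneous_coord_mult[OF p(1), of i] obtain q where
    "homogeneous (Suc d) q" "\<forall>x. peval q x = x i * peval p x" by blast
  with p(2) show ?case by (intro exI[of _ q]) (simp add: field_simps)
qed

lemma homogeneous_components:
  fixes f :: "complex ^ 'n \<Rightarrow> complex"
  assumes "pf UNIV d f"
  shows "\<exists>p. (\<forall>k. homogeneous k (p k)) \<and> (\<forall>v. f v = (\<Sum>k\<le>d. peval (p k) (($) v)))"
  using assms
proof (induction rule: pf.induct)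
  case (pf_const d c)
  have "homogeneous 0 (Poly_Mapping.single (0 :: 'n \<Rightarrow>\<^sub>0 nat) c)"
    by (intro homogeneous_single) simp
  moreover have "(\<Sum>k\<le>d. peval (if k = 0 then Poly_Mapping.single (0 :: 'n \<Rightarrow>\<^sub>0 nat) c else 0) (($) v)) = c" for v
  proof -
    have "(\<Sum>k\<le>d. peval (if k = 0 then Poly_Mapping.single (0 :: 'n \<Rightarrow>\<^sub>0 nat) c else 0) (($) v)) = (\<Sum>k\<le>d. if k = 0 then c else 0)"
      by (intro sum.cong) (auto simp: peval_single mono_eval_def)
    then show ?thesis by simp
  qed
  ultimately show ?case
    by (intro exI[of _ "\<lambda>k. if k = 0 then Poly_Mapping.single 0 c else 0"]) simp
next
  case (pf_add d f g)
  then obtain p q where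
    "\<forall>k. homogeneous k (p k)" "\<forall>v. f v = (\<Sum>k\<le>d. peval (p k) (($) v))"
    "\<forall>k. homogeneous k (q k)" "\<forall>v. g v = (\<Sum>k\<le>d. peval (q k) (($) v))" by blast
  then show ?case
    by (intro exI[of _ "\<lambda>k. p k + q k"]) (simp add: homogeneous_add peval_add sum.distrib)
next
  case (pf_coord d f i)
  then obtain p where p: "\<forall>k. homogeneous k (p k)" "\<forall>v. f v = (\<Sum>k\<le>d. peval (p k) (($) v))" by blast
  from p(1) have "\<forall>k. \<exists>q. homogeneous (Suc k) q \<and> (\<forall>x. peval q x = x i * peval (p k) x)"
    by (blast intro: homogeneous_coord_mult)
  then obtain q where q: "\<And>k. homogeneous (Suc k) (q k)" "\<And>k x. peval (q k) x = x i * peval (p k) x"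
    by metis
  have "homogeneous k (case k of 0 \<Rightarrow> 0 | Suc k \<Rightarrow> q k)" for k
    using q(1) by (cases k) auto
  moreover have "v $ i * f v = (\<Sum>k\<le>Suc d. peval (case k of 0 \<Rightarrow> 0 | Suc k \<Rightarrow> q k) (($) v))" for v
    unfolding sum.atMost_Suc_shift using p(2) by (simp add: q(2) sum_distrib_left)
  ultimately show ?case by (intro exI[of _ "\<lambda>k. case k of 0 \<Rightarrow> 0 | Suc k \<Rightarrow> q k"]) auto
qed

lemma pf_peval:
  fixes p :: "'n::finite cpoly"
  assumes "p \<in> polys_in E"
  shows "\<exists>d. pf E d (\<lambda>v. peval p (($) v))"
proof -
  have mono: "\<exists>d. pf E d (\<lambda>v. Poly_Mapping.lookup p m * mono_eval m (($) v))" if "m \<in> Poly_Mapping.keys p" for m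
  proof -
    have "pf E (Poly_Mapping.lookup m i * Suc 0) (\<lambda>v. v $ i ^ Poly_Mapping.lookup m i)" if "i \<in> Poly_Mapping.keys m" for i
      using assms \<open>m \<in> _\<close> that by (intro pf_power pf_var) (auto simp: polys_in_def)
    then have "pf E (\<Sum>i\<in>Poly_Mapping.keys m. Poly_Mapping.lookup m i * Suc 0) (\<lambda>v. \<Prod>i\<in>Poly_Mapping.keys m. v $ i ^ Poly_Mapping.lookup m i)"
      by (intro pf_prod) auto
    then show ?thesis unfolding mono_eval_def using pf_cmult by blast
  qed
  have "\<exists>d. pf E d (\<lambda>v. \<Sum>m\<in>K. Poly_Mapping.lookup p m * mono_eval m (($) v))" if "finite K" "K \<subseteq> Poly_Mapping.keys p" for K
    using that
  proof (induction K rule: finite_induct)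
    case empty
    show ?case using pf_const by auto
  next
    case (insert m K)
    then obtain d d' where d: "pf E d (\<lambda>v. Poly_Mapping.lookup p m * mono_eval m (($) v))"
      "pf E d' (\<lambda>v. \<Sum>m\<in>K. Poly_Mapping.lookup p m * mono_eval m (($) v))"
      using mono[of m] by auto
    have "pf E (max d d') (\<lambda>v. Poly_Mapping.lookup p m * mono_eval m (($) v) + (\<Sum>m\<in>K. Poly_Mapping.lookup p m * mono_eval m (($) v)))"
      using d by (intro pf_add) (auto elim: pf_mono)
    with insert show ?case by auto
  qed
  from this[of "Poly_Mapping.keys p"] show ?thesis by (simp add: peval_altdef)
qed

text \<open>Monomials are distinct characters of the multiplicative monoid of \<open>\<complex>\<^sup>n\<close>, so Dedekind's
  argument for the linear independence of characters applies.\<close>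

lemma mono_eval_independent:
  fixes K :: "('n::finite \<Rightarrow>\<^sub>0 nat) set"
  assumes "finite K" "\<And>x. (\<Sum>m\<in>K. c m * mono_eval m x) = 0" "m \<in> K"
  shows "c m = 0"
  using assms
proof (induction K arbitrary: c m rule: finite_induct)
  case (insert n K)
  have sum: "c n * mono_eval n x + (\<Sum>m\<in>K. c m * mono_eval m x) = 0" for x
    using insert.prems(1)[of x] insert.hyps by simp
  have K: "c m = 0" if m: "m \<in> K" for m
  proof -
    from m insert.hyps have "m \<noteq> n" by auto
    then obtain i where i: "Poly_Mapping.lookup m i \<noteq> Poly_Mapping.lookup n i"
      by (meson poly_mapping_eqI)
    \<comment> \<open>The character \<open>n\<close> is eliminated by evaluating the relation at the
      product of \<open>x\<close> and \<open>y\<close> and subtracting \<open>mono_eval n y\<close>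
      times the relation at \<open>x\<close>. The point \<open>y\<close> tells \<open>m\<close> and
      \<open>n\<close> apart because distinct powers of 2 differ.\<close>
    define y where "y = (\<lambda>j. if j = i then 2 else 1 :: complex)"
    have y: "mono_eval k y = 2 ^ Poly_Mapping.lookup k i" for k
    proof -
      have "mono_eval k y = (\<Prod>j\<in>UNIV. if j = i then 2 ^ Poly_Mapping.lookup k j else 1)"
        unfolding mono_eval_UNIV y_def by (intro prod.cong) auto
      then show ?thesis by simp
    qed
    have "(\<Sum>m\<in>K. (c m * (mono_eval m y - mono_eval n y)) * mono_eval m x) = 0" for x
    proof -
      have "mono_eval k (\<lambda>j. x j * y j) = mono_eval k x * mono_eval k y" for k
        by (simp add: mono_eval_UNIV power_mult_distrib prod.distrib)
      with sum[of "\<lambda>j. x j * y j"]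
      have 1: "c n * (mono_eval n x * mono_eval n y) + (\<Sum>m\<in>K. c m * (mono_eval m x * mono_eval m y)) = 0" by simp
      have 2: "(c n * mono_eval n x + (\<Sum>m\<in>K. c m * mono_eval m x)) * mono_eval n y = 0"
        using sum[of x] by simp
      have "(\<Sum>m\<in>K. (c m * (mono_eval m y - mono_eval n y)) * mono_eval m x)
        = (\<Sum>m\<in>K. c m * (mono_eval m x * mono_eval m y)) - (\<Sum>m\<in>K. c m * mono_eval m x) * mono_eval n y"
        by (simp add: algebra_simps sum_subtractf sum_distrib_left)
      also have "\<dots> = (c n * (mono_eval n x * mono_eval n y) + (\<Sum>m\<in>K. c m * (mono_eval m x * mono_eval m y)))
          - (c n * mono_eval n x + (\<Sum>m\<in>K. c m * mono_eval m x)) * mono_eval n y"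
        by (simp add: distrib_right mult.assoc)
      also have "\<dots> = 0" unfolding 1 2 by simp
      finally show ?thesis .
    qed
    from insert.IH[OF this m] have "c m * (mono_eval m y - mono_eval n y) = 0" .
    moreover have "(2::complex) ^ a \<noteq> 2 ^ b" if "a \<noteq> b" for a b :: nat
    proof
      assume "(2::complex) ^ a = 2 ^ b"
      then have "norm ((2::complex) ^ a) = norm ((2::complex) ^ b)" by simp
      then show False using that by (simp add: norm_power)
    qed
    ultimately show ?thesis using i y by auto
  qed
  moreover have "c n = 0"
    using sum[of "\<lambda>_. 1"] K by (simp add: mono_eval_def)
  ultimately show ?case using insert.prems(2) by auto
qed simp

lemma peval_eq_0_imp:
  fixes p :: "'n::finite cpoly"
  assumes "\<And>v :: complex ^ 'n. peval p (($) v) = 0"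
  shows "p = 0"
proof -
  have "(\<Sum>m\<in>Poly_Mapping.keys p. Poly_Mapping.lookup p m * mono_eval m x) = 0" for x
    using assms[of "\<chi> i. x i"] by (simp add: peval_altdef vec_lambda_inverse)
  from mono_eval_independent[OF finite_keys this] show ?thesis
    by (metis in_keys_iff lookup_zero poly_mapping_eqI)
qed

text \<open>Distinct monomials in the variables 0 and 1 land at distinct coefficient positions of
  \<open>Q\<close>, so nothing cancels. This carries the dependence in the definition of
  \<open>proj_dim\<close> over to \<open>ev\<close>.\<close>

lemma peval_bivariate:
  fixes P :: "nat cpoly"
  assumes "P \<in> polys_in {..<2}" "P \<noteq> 0"
  shows "\<exists>Q. Q \<noteq> 0 \<and> (\<forall>x. peval P x = ev Q (x 0) (x 1))"
proof -
  define Q where "Q = (\<Sum>m\<in>Poly_Mapping.keys P.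
    monom (monom (Poly_Mapping.lookup P m) (Poly_Mapping.lookup m 0)) (Poly_Mapping.lookup m 1))"
  have keys: "Poly_Mapping.keys m \<subseteq> {0, 1}" if "m \<in> Poly_Mapping.keys P" for m
    using assms(1) that unfolding polys_in_def by (fastforce simp: numeral_2_eq_2 lessThan_Suc)
  have "peval P x = ev Q (x 0) (x 1)" for x
  proof -
    have "mono_eval m x = x 0 ^ Poly_Mapping.lookup m 0 * x 1 ^ Poly_Mapping.lookup m 1" if "m \<in> Poly_Mapping.keys P" for m
      using mono_eval_superset[OF _ keys[OF that], of x] by simp
    then show ?thesis
      by (simp add: peval_altdef Q_def ev_def poly_sum poly_monom poly_power mult.assoc)
  qed
  moreover have "Q \<noteq> 0"
  proof -
    obtain n where n: "n \<in> Poly_Mapping.keys P"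
      using assms(2) by (metis in_keys_iff lookup_zero poly_mapping_eqI)
    have eq: "m = n" if "m \<in> Poly_Mapping.keys P" "Poly_Mapping.lookup m 0 = Poly_Mapping.lookup n 0"
      "Poly_Mapping.lookup m 1 = Poly_Mapping.lookup n 1" for m
    proof (rule poly_mapping_eqI)
      fix k show "Poly_Mapping.lookup m k = Poly_Mapping.lookup n k"
        using keys[OF that(1)] keys[OF n] that(2,3)
        by (cases "k \<in> {0,1}") (use in_keys_iff[of k m] in_keys_iff[of k n] in auto)
    qed
    have "coeff (coeff Q (Poly_Mapping.lookup n 1)) (Poly_Mapping.lookup n 0)
      = (\<Sum>m\<in>Poly_Mapping.keys P. if m = n then Poly_Mapping.lookup P m else 0)"
      unfolding Q_def coeff_sum using eq by (intro sum.cong) (auto simp: coeff_monom)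
    also have "\<dots> = Poly_Mapping.lookup P n" using n by simp
    also have "\<dots> \<noteq> 0" using n by (simp add: in_keys_iff)
    finally show ?thesis by auto
  qed
  ultimately show ?thesis by blast
qed

section \<open>Linear dependence modulo a subspace of functions\<close>

text \<open>Gaussian elimination: if equation \<open>t\<close> has a nonzero coefficient at
  \<open>r\<close>, the unknown \<open>u r\<close> is solved for and substituted into the other
  equations.\<close>

lemma nontrivial_kernel:
  fixes c :: "'s \<Rightarrow> 't \<Rightarrow> complex"
  assumes "finite T" "finite S" "card T < card S"
  shows "\<exists>u. (\<exists>s\<in>S. u s \<noteq> 0) \<and> (\<forall>t\<in>T. (\<Sum>s\<in>S. u s * c s t) = 0)"
  using assms
proof (induction T arbitrary: S c rule: finite_induct)
  case empty
  then obtain s where "s \<in> S" by fastforce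
  then show ?case by (intro exI[of _ "\<lambda>_. 1"]) auto
next
  case (insert t T)
  show ?case
  proof (cases "\<forall>s\<in>S. c s t = 0")
    case True
    from insert.IH[of S c] insert.prems insert.hyps obtain u where
      "\<exists>s\<in>S. u s \<noteq> 0" "\<forall>t\<in>T. (\<Sum>s\<in>S. u s * c s t) = 0" by auto
    with True show ?thesis by (intro exI[of _ u]) auto
  next
    case False
    then obtain r where r: "r \<in> S" "c r t \<noteq> 0" by blast
    have "card T < card (S - {r})" using insert.prems insert.hyps r by auto
    from insert.IH[OF _ this, of "\<lambda>s t'. c s t' - c s t / c r t * c r t'"] insert.prems obtain u where
      u: "\<exists>s\<in>S - {r}. u s \<noteq> 0"
      "\<forall>t'\<in>T. (\<Sum>s\<in>S - {r}. u s * (c s t' - c s t / c r t * c r t')) = 0" by auto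
    define w where "w = u(r := - (\<Sum>s\<in>S - {r}. u s * c s t) / c r t)"
    have w: "(\<Sum>s\<in>S. w s * c s t') = (\<Sum>s\<in>S - {r}. u s * c s t') - (\<Sum>s\<in>S - {r}. u s * c s t) / c r t * c r t'" for t'
    proof -
      have "(\<Sum>s\<in>S. w s * c s t') = w r * c r t' + (\<Sum>s\<in>S - {r}. w s * c s t')"
        using insert.prems r by (intro sum.remove) auto
      also have "(\<Sum>s\<in>S - {r}. w s * c s t') = (\<Sum>s\<in>S - {r}. u s * c s t')"
        by (intro sum.cong) (auto simp: w_def)
      finally show ?thesis by (simp add: w_def)
    qed
    have "(\<Sum>s\<in>S. w s * c s t') = 0" if "t' \<in> insert t T" for t'
    proof (cases "t' = t")
      case True
      then show ?thesis using r(2) by (simp add: w)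
    next
      case False
      then have "(\<Sum>s\<in>S - {r}. u s * (c s t' - c s t / c r t * c r t')) = 0" using u(2) that by auto
      then show ?thesis unfolding w
        by (simp add: right_diff_distrib sum_subtractf sum_divide_distrib sum_distrib_right mult.assoc)
    qed
    moreover have "\<exists>s\<in>S. w s \<noteq> 0" using u(1) by (auto simp: w_def)
    ultimately show ?thesis by blast
  qed
qed

definition fsubspace :: "('a \<Rightarrow> complex) set \<Rightarrow> bool" where
  "fsubspace J \<longleftrightarrow> (\<lambda>_. 0) \<in> J \<and> (\<forall>f\<in>J. \<forall>g\<in>J. (\<lambda>v. f v + g v) \<in> J) \<and> (\<forall>c. \<forall>f\<in>J. (\<lambda>v. c * f v) \<in> J)"

lemma fsubspace_0: "fsubspace J \<Longrightarrow> (\<lambda>_. 0) \<in> J"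
  and fsubspace_add: "fsubspace J \<Longrightarrow> f \<in> J \<Longrightarrow> g \<in> J \<Longrightarrow> (\<lambda>v. f v + g v) \<in> J"
  and fsubspace_scale: "fsubspace J \<Longrightarrow> f \<in> J \<Longrightarrow> (\<lambda>v. c * f v) \<in> J"
  by (auto simp: fsubspace_def)

lemma fsubspace_sum:
  "fsubspace J \<Longrightarrow> (\<And>i. i \<in> I \<Longrightarrow> f i \<in> J) \<Longrightarrow> (\<lambda>v. \<Sum>i\<in>I. f i v) \<in> J"
  by (induction I rule: infinite_finite_induct) (auto simp: fsubspace_0 fsubspace_add)

text \<open>The preimage of the span of the \<open>b t\<close> under the quotient map by
  \<open>J\<close>, so that dimensions modulo \<open>J\<close> are bounded by \<open>card T\<close>
  without forming the quotient.\<close>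

definition span_mod :: "('a \<Rightarrow> complex) set \<Rightarrow> 't set \<Rightarrow> ('t \<Rightarrow> 'a \<Rightarrow> complex) \<Rightarrow> ('a \<Rightarrow> complex) set" where
  "span_mod J T b = {f. \<exists>c. (\<lambda>v. f v - (\<Sum>t\<in>T. c t * b t v)) \<in> J}"

lemma fsubspace_span_mod:
  assumes "fsubspace J"
  shows "fsubspace (span_mod J T b)"
  unfolding fsubspace_def
proof (intro conjI ballI allI)
  show "(\<lambda>_. 0) \<in> span_mod J T b"
    unfolding span_mod_def using fsubspace_0[OF assms] by (auto intro!: exI[of _ "\<lambda>_. 0"])
next
  fix f g assume "f \<in> span_mod J T b" "g \<in> span_mod J T b"
  then obtain c d where "(\<lambda>v. f v - (\<Sum>t\<in>T. c t * b t v)) \<in> J" "(\<lambda>v. g v - (\<Sum>t\<in>T. d t * b t v)) \<in> J"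
    by (auto simp: span_mod_def)
  from fsubspace_add[OF assms this]
  have "(\<lambda>v. f v + g v - (\<Sum>t\<in>T. (c t + d t) * b t v)) \<in> J"
    by (simp add: distrib_right sum.distrib algebra_simps)
  then show "(\<lambda>v. f v + g v) \<in> span_mod J T b"
    unfolding span_mod_def mem_Collect_eq by (rule exI[of _ "\<lambda>t. c t + d t"])
next
  fix a f assume "f \<in> span_mod J T b"
  then obtain c where "(\<lambda>v. f v - (\<Sum>t\<in>T. c t * b t v)) \<in> J"
    by (auto simp: span_mod_def)
  from fsubspace_scale[OF assms this, of a]
  have "(\<lambda>v. a * f v - (\<Sum>t\<in>T. (a * c t) * b t v)) \<in> J"
    by (simp add: right_diff_distrib sum_distrib_left mult.assoc)
  then show "(\<lambda>v. a * f v) \<in> span_mod J T b"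
    unfolding span_mod_def mem_Collect_eq by (rule exI[of _ "\<lambda>t. a * c t"])
qed

lemma span_mod_base:
  assumes "fsubspace J" "finite T" "t \<in> T"
  shows "b t \<in> span_mod J T b"
proof -
  have "(\<Sum>s\<in>T. (if s = t then 1 else 0) * b s v) = b t v" for v
    using assms by (simp add: if_distrib[of "\<lambda>x. x * _"] cong: if_cong)
  then show ?thesis unfolding span_mod_def
    using fsubspace_0[OF assms(1)] by (auto intro!: exI[of _ "\<lambda>s. if s = t then 1 else 0"])
qed

lemma span_mod_ideal:
  assumes "f \<in> J"
  shows "f \<in> span_mod J T b"
  unfolding span_mod_def using assms by (auto intro!: exI[of _ "\<lambda>_. 0"])

lemma span_mod_mult:
  assumes J: "fsubspace J" and f: "f \<in> span_mod J T b"
    and base: "\<And>t. t \<in> T \<Longrightarrow> (\<lambda>v. m v * b t v) \<in> span_mod J T' b"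
    and ideal: "\<And>g. g \<in> J \<Longrightarrow> (\<lambda>v. m v * g v) \<in> J"
  shows "(\<lambda>v. m v * f v) \<in> span_mod J T' b"
proof -
  note sub = fsubspace_span_mod[OF J, of T' b]
  from f obtain c where c: "(\<lambda>v. f v - (\<Sum>t\<in>T. c t * b t v)) \<in> J" by (auto simp: span_mod_def)
  have "(\<lambda>v. m v * (f v - (\<Sum>t\<in>T. c t * b t v))) \<in> span_mod J T' b"
    using ideal[OF c] by (rule span_mod_ideal)
  moreover have "(\<lambda>v. \<Sum>t\<in>T. c t * (m v * b t v)) \<in> span_mod J T' b"
    by (intro fsubspace_sum[OF sub] fsubspace_scale[OF sub] base)
  ultimately have "(\<lambda>v. m v * (f v - (\<Sum>t\<in>T. c t * b t v)) + (\<Sum>t\<in>T. c t * (m v * b t v))) \<in> span_mod J T' b"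
    by (rule fsubspace_add[OF sub])
  then show ?thesis by (simp add: right_diff_distrib sum_distrib_left mult_ac)
qed

lemma span_mod_dependence:
  assumes J: "fsubspace J" and "finite S" "finite T" "card T < card S"
    and f: "\<And>s. s \<in> S \<Longrightarrow> f s \<in> span_mod J T b"
  shows "\<exists>u. (\<exists>s\<in>S. u s \<noteq> 0) \<and> (\<lambda>v. \<Sum>s\<in>S. u s * f s v) \<in> J"
proof -
  have "\<forall>s\<in>S. \<exists>c. (\<lambda>v. f s v - (\<Sum>t\<in>T. c t * b t v)) \<in> J"
    using f by (auto simp: span_mod_def)
  then obtain c where c: "\<And>s. s \<in> S \<Longrightarrow> (\<lambda>v. f s v - (\<Sum>t\<in>T. c s t * b t v)) \<in> J" by metis
  from nontrivial_kernel[OF assms(3,2,4), of c] obtain u where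
    u: "\<exists>s\<in>S. u s \<noteq> 0" "\<And>t. t \<in> T \<Longrightarrow> (\<Sum>s\<in>S. u s * c s t) = 0" by blast
  have "(\<lambda>v. \<Sum>s\<in>S. u s * (f s v - (\<Sum>t\<in>T. c s t * b t v))) \<in> J"
    by (intro fsubspace_sum[OF J] fsubspace_scale[OF J] c)
  moreover have "(\<Sum>s\<in>S. u s * (f s v - (\<Sum>t\<in>T. c s t * b t v))) = (\<Sum>s\<in>S. u s * f s v)" for v
  proof -
    have "(\<Sum>s\<in>S. u s * (\<Sum>t\<in>T. c s t * b t v)) = (\<Sum>t\<in>T. (\<Sum>s\<in>S. u s * c s t) * b t v)"
      by (simp add: sum_distrib_left sum_distrib_right mult.assoc) (rule sum.swap)
    also have "\<dots> = 0" using u(2) by simp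
    finally show ?thesis by (simp add: right_diff_distrib sum_subtractf)
  qed
  ultimately show ?thesis using u(1) by (intro exI[of _ u]) simp
qed

text \<open>\<open>A\<close> acts as a common denominator of the coordinates of \<open>z\<close>:
  each coordinate factor is absorbed together with one \<open>A\<close>, at the price of one step in
  the filtration \<open>R\<close>, and lower degrees are padded by \<open>A\<close> alone. It serves
  single points as well as sums of points.\<close>

lemma pf_growth:
  fixes z :: "'a \<Rightarrow> complex ^ 'n"
  assumes R: "\<And>d. fsubspace (R d)" and one: "(\<lambda>_. 1) \<in> R 0"
    and stepA: "\<And>d f. f \<in> R d \<Longrightarrow> (\<lambda>u. A u * f u) \<in> R (Suc d)"
    and stepz: "\<And>d f l. f \<in> R d \<Longrightarrow> (\<lambda>u. A u * z u $ l * f u) \<in> R (Suc d)"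
    and "pf UNIV d f"
  shows "(\<lambda>u. A u ^ d * f (z u)) \<in> R d"
  using assms(5)
proof (induction rule: pf.induct)
  case (pf_const d c)
  have "(\<lambda>u. A u ^ d) \<in> R d"
  proof (induction d)
    case (Suc d)
    from stepA[OF this] show ?case by simp
  qed (simp add: one)
  from fsubspace_scale[OF R this, of c] show ?case by (simp add: mult.commute)
next
  case (pf_add d f g)
  from fsubspace_add[OF R pf_add.IH] show ?case by (simp add: distrib_left)
next
  case (pf_coord d f i)
  from stepz[OF pf_coord.IH, of i] show ?case by (simp add: mult_ac)
qed

section \<open>Reduction modulo a triangular system\<close>

definition rel :: "'n \<Rightarrow> ('n \<Rightarrow> complex poly poly) \<Rightarrow> 'n \<Rightarrow> complex ^ 'n \<Rightarrow> complex" where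
  "rel k P i v = ev (P i) (v $ k) (v $ i)"

definition rel_ideal :: "'n \<Rightarrow> ('n \<Rightarrow> complex poly poly) \<Rightarrow> (complex ^ 'n \<Rightarrow> complex) set" where
  "rel_ideal k P = {f. \<exists>h. (\<forall>i. polyf (h i)) \<and> f = (\<lambda>v. \<Sum>i\<in>UNIV. h i v * rel k P i v)}"

text \<open>The exponents below \<open>degree (P i)\<close> are those of remainders on division by
  the relations; \<open>C\<close> is the growth of the degree in \<open>v $ k\<close> per reduction
  step.\<close>

definition red_index :: "('n \<Rightarrow> complex poly poly) \<Rightarrow> nat \<Rightarrow> nat \<Rightarrow> (nat \<times> ('n \<Rightarrow> nat)) set" where
  "red_index P C d = {..C * d} \<times> (\<Pi>\<^sub>E i\<in>UNIV. {..<degree (P i)})"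

definition red_mono :: "'n \<Rightarrow> nat \<times> ('n \<Rightarrow> nat) \<Rightarrow> complex ^ 'n \<Rightarrow> complex" where
  "red_mono k t v = v $ k ^ fst t * (\<Prod>i\<in>UNIV. v $ i ^ snd t i)"

text \<open>Multiplied by this factor, the relation of \<open>l\<close> gets the leading coefficient
  \<open>lead_prod P\<close>, the same for every \<open>l\<close>; one multiplier thus serves all
  coordinates.\<close>

definition lead_except :: "('n \<Rightarrow> complex poly poly) \<Rightarrow> 'n \<Rightarrow> complex poly" where
  "lead_except P l = (\<Prod>i\<in>UNIV - {l}. lead_coeff (P i))"

definition lead_prod :: "('n \<Rightarrow> complex poly poly) \<Rightarrow> complex poly" where
  "lead_prod P = (\<Prod>i\<in>UNIV. lead_coeff (P i))"

text \<open>These products are the coefficients that a reduction step introduces. The case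
  \<open>q = degree (P l)\<close> bounds the degree of \<open>lead_prod P\<close> itself.\<close>

definition red_bound :: "('n \<Rightarrow> complex poly poly) \<Rightarrow> nat \<Rightarrow> bool" where
  "red_bound P C \<longleftrightarrow> (\<forall>l. \<forall>q\<le>degree (P l). degree (lead_except P l * coeff (P l) q) \<le> C)"

lemma red_bound_exists: "\<exists>C. red_bound P C" for P :: "'n::finite \<Rightarrow> complex poly poly"
proof -
  let ?S = "(\<lambda>(l, q). degree (lead_except P l * coeff (P l) q)) ` (SIGMA l:UNIV. {..degree (P l)})"
  have "finite ?S" by auto
  then obtain C where C: "\<forall>x\<in>?S. x \<le> C" using finite_nat_set_iff_bounded_le by blast
  have "degree (lead_except P l * coeff (P l) q) \<in> ?S" if "q \<le> degree (P l)" for l q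
    using that by (intro image_eqI[of _ _ "(l, q)"]) auto
  with C show ?thesis unfolding red_bound_def by blast
qed

lemma lead_prod_split: "lead_prod P = lead_except P l * lead_coeff (P l)" for P :: "'n::finite \<Rightarrow> complex poly poly"
  unfolding lead_prod_def lead_except_def by (simp add: prod.remove[of UNIV l] mult.commute)

lemma finite_red_index: "finite (red_index P C d)" for P :: "'n::finite \<Rightarrow> complex poly poly"
  unfolding red_index_def by (auto intro!: finite_PiE)

lemma card_red_index: "card (red_index P C d) = (C * d + 1) * (\<Prod>i\<in>UNIV. degree (P i))"
  for P :: "'n::finite \<Rightarrow> complex poly poly"
  unfolding red_index_def by (simp add: card_cartesian_product card_PiE)

lemma fsubspace_rel_ideal: "fsubspace (rel_ideal k P)"
  unfolding fsubspace_def
proof (intro conjI ballI allI)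
  show "(\<lambda>_. 0) \<in> rel_ideal k P"
    unfolding rel_ideal_def by (auto intro!: exI[of _ "\<lambda>_ _. 0"])
next
  fix f g assume "f \<in> rel_ideal k P" "g \<in> rel_ideal k P"
  then obtain a b where "\<forall>i. polyf (a i)" "\<forall>i. polyf (b i)"
    "f = (\<lambda>v. \<Sum>i\<in>UNIV. a i v * rel k P i v)" "g = (\<lambda>v. \<Sum>i\<in>UNIV. b i v * rel k P i v)"
    by (auto simp: rel_ideal_def)
  then show "(\<lambda>v. f v + g v) \<in> rel_ideal k P"
    unfolding rel_ideal_def
    by (auto simp: distrib_right sum.distrib intro!: exI[of _ "\<lambda>i v. a i v + b i v"] polyf_add)
next
  fix c f assume "f \<in> rel_ideal k P"
  then obtain a where "\<forall>i. polyf (a i)" "f = (\<lambda>v. \<Sum>i\<in>UNIV. a i v * rel k P i v)"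
    by (auto simp: rel_ideal_def)
  then show "(\<lambda>v. c * f v) \<in> rel_ideal k P"
    unfolding rel_ideal_def
    by (auto simp: sum_distrib_left mult.assoc intro!: exI[of _ "\<lambda>i v. c * a i v"] polyf_mult)
qed

lemma rel_ideal_mult:
  assumes "f \<in> rel_ideal k P" "polyf g"
  shows "(\<lambda>v. g v * f v) \<in> rel_ideal k P"
proof -
  from assms(1) obtain a where "\<forall>i. polyf (a i)" "f = (\<lambda>v. \<Sum>i\<in>UNIV. a i v * rel k P i v)"
    by (auto simp: rel_ideal_def)
  with assms(2) show ?thesis
    unfolding rel_ideal_def
    by (auto simp: sum_distrib_left mult.assoc intro!: exI[of _ "\<lambda>i v. g v * a i v"] polyf_mult)
qed

lemma rel_in_rel_ideal: "rel k P l \<in> rel_ideal k P"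
proof -
  have "rel k P l v = (\<Sum>i\<in>UNIV. (if i = l then 1 else 0) * rel k P i v)" for v
    by (simp add: if_distrib[of "\<lambda>x. x * _"] cong: if_cong)
  then show ?thesis unfolding rel_ideal_def
    by (auto intro!: exI[of _ "\<lambda>i _. if i = l then 1 else 0"])
qed

lemma red_poly:
  fixes P :: "'n::finite \<Rightarrow> complex poly poly"
  assumes "degree c \<le> C" "(j, e) \<in> red_index P C d"
  shows "(\<lambda>v. poly c (v $ k) * red_mono k (j, e) v) \<in> span_mod (rel_ideal k P) (red_index P C (Suc d)) (red_mono k)"
proof -
  note sub = fsubspace_span_mod[OF fsubspace_rel_ideal]
  have "red_mono k (j + q, e) \<in> span_mod (rel_ideal k P) (red_index P C (Suc d)) (red_mono k)" if "q \<le> degree c" for q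
    using assms that by (intro span_mod_base fsubspace_rel_ideal finite_red_index) (auto simp: red_index_def)
  then have "(\<lambda>v. \<Sum>q\<le>degree c. coeff c q * red_mono k (j + q, e) v) \<in> span_mod (rel_ideal k P) (red_index P C (Suc d)) (red_mono k)"
    by (intro fsubspace_sum[OF sub] fsubspace_scale[OF sub]) auto
  moreover have "(\<Sum>q\<le>degree c. coeff c q * red_mono k (j + q, e) v) = poly c (v $ k) * red_mono k (j, e) v" for v
    unfolding poly_altdef sum_distrib_right
    by (intro sum.cong refl) (simp add: red_mono_def power_add mult_ac)
  ultimately show ?thesis by simp
qed

lemma red_step_lead:
  fixes P :: "'n::finite \<Rightarrow> complex poly poly"
  assumes "red_bound P C" "t \<in> red_index P C d"
  shows "(\<lambda>v. poly (lead_prod P) (v $ k) * red_mono k t v) \<in> span_mod (rel_ideal k P) (red_index P C (Suc d)) (red_mono k)"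
proof -
  have "degree (lead_prod P) \<le> C"
    using assms(1) lead_prod_split[of P undefined] by (auto simp: red_bound_def)
  with red_poly[of "lead_prod P" C "fst t" "snd t"] assms(2) show ?thesis by simp
qed

lemma red_step_coord:
  fixes P :: "'n::finite \<Rightarrow> complex poly poly"
  assumes C: "red_bound P C" and t: "t \<in> red_index P C d"
  shows "(\<lambda>v. poly (lead_prod P) (v $ k) * v $ l * red_mono k t v) \<in> span_mod (rel_ideal k P) (red_index P C (Suc d)) (red_mono k)"
    (is "_ \<in> ?R")
proof -
  note J = fsubspace_rel_ideal[of k P]
  note sub = fsubspace_span_mod[OF J]
  obtain j e where te: "t = (j, e)" by fastforce
  let ?D = "degree (P l)"
  have el: "e l < ?D" and e: "\<And>i. e i < degree (P i)" and j: "j \<le> C * d"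
    using t by (auto simp: te red_index_def)
  have mono: "red_mono k (j, e(l := q)) v = v $ k ^ j * (v $ l ^ q * (\<Prod>i\<in>UNIV - {l}. v $ i ^ e i))" for q v
    by (simp add: red_mono_def prod.remove[of UNIV l])
  have mono_e: "v $ l * red_mono k (j, e) v = red_mono k (j, e(l := Suc (e l))) v" for v
    using mono[of "e l" v] by (simp add: mono)
  have idx: "(j, e(l := q)) \<in> red_index P C d" if "q < ?D" for q
    using e j that by (auto simp: red_index_def)
  show ?thesis
  proof (cases "Suc (e l) < ?D")
    case True
    from red_step_lead[OF C idx[OF True], of k] show ?thesis
      by (simp add: te mono_e mult.assoc)
  next
    case False
    with el have D: "Suc (e l) = ?D" by simp
    \<comment> \<open>The top term of \<open>g\<close> times the relation of \<open>l\<close> is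
      \<open>lead_prod P\<close> times the overflowing monomial, with exponent \<open>?D\<close> at
      \<open>l\<close>. Solving for it leaves exponents \<open>q < ?D\<close>, which are
      reduced.\<close>
    define g where "g v = poly (lead_except P l) (v $ k) * (v $ k ^ j * (\<Prod>i\<in>UNIV - {l}. v $ i ^ e i))" for v :: "complex ^ 'n"
    have "polyf g" unfolding g_def by (intro polyf_mult polyf_power polyf_prod polyf_poly polyf_var)
    then have "(\<lambda>v. g v * rel k P l v) \<in> ?R"
      by (intro span_mod_ideal rel_ideal_mult rel_in_rel_ideal)
    moreover have "(\<lambda>v. \<Sum>q<?D. - 1 * (poly (lead_except P l * coeff (P l) q) (v $ k) * red_mono k (j, e(l := q)) v)) \<in> ?R"
    proof (intro fsubspace_sum[OF sub] fsubspace_scale[OF sub] red_poly idx)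
      fix q assume q: "q \<in> {..<?D}"
      then show "q < ?D" by simp
      from q show "degree (lead_except P l * coeff (P l) q) \<le> C" using C by (auto simp: red_bound_def)
    qed
    ultimately have "(\<lambda>v. g v * rel k P l v + (\<Sum>q<?D. - 1 * (poly (lead_except P l * coeff (P l) q) (v $ k) * red_mono k (j, e(l := q)) v))) \<in> ?R"
      by (rule fsubspace_add[OF sub])
    moreover have "g v * rel k P l v + (\<Sum>q<?D. - 1 * (poly (lead_except P l * coeff (P l) q) (v $ k) * red_mono k (j, e(l := q)) v))
      = poly (lead_prod P) (v $ k) * v $ l * red_mono k t v" for v
    proof -
      have "g v * rel k P l v = (\<Sum>q\<le>?D. poly (lead_except P l * coeff (P l) q) (v $ k) * red_mono k (j, e(l := q)) v)"
        unfolding rel_def ev_altdef sum_distrib_left by (intro sum.cong) (simp_all add: g_def mono mult_ac)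
      also have "\<dots> = (\<Sum>q<?D. poly (lead_except P l * coeff (P l) q) (v $ k) * red_mono k (j, e(l := q)) v)
          + poly (lead_prod P) (v $ k) * red_mono k (j, e(l := ?D)) v"
        by (simp add: lessThan_Suc_atMost[symmetric] lead_prod_split[of P l])
      finally show ?thesis
        by (simp add: te mult.assoc mono_e D sum_negf)
    qed
    ultimately show ?thesis by simp
  qed
qed

text \<open>Division with remainder by all relations at once, with one factor
  \<open>lead_prod P\<close> paid per degree. Positive degrees of the relations make the constant 1
  a reduced monomial.\<close>

lemma red_pf:
  fixes P :: "'n::finite \<Rightarrow> complex poly poly"
  assumes C: "red_bound P C" and pos: "\<And>i. degree (P i) > 0" and f: "pf UNIV d f"
  shows "(\<lambda>v. poly (lead_prod P) (v $ k) ^ d * f v) \<in> span_mod (rel_ideal k P) (red_index P C d) (red_mono k)"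
proof (rule pf_growth[where z = "\<lambda>v. v", OF _ _ _ _ f])
  note J = fsubspace_rel_ideal[of k P]
  show "fsubspace (span_mod (rel_ideal k P) (red_index P C d) (red_mono k))" for d
    by (rule fsubspace_span_mod[OF J])
  have "red_mono k (0, \<lambda>_. 0) \<in> span_mod (rel_ideal k P) (red_index P C 0) (red_mono k)"
    using pos by (intro span_mod_base J finite_red_index) (auto simp: red_index_def)
  then show "(\<lambda>_. 1) \<in> span_mod (rel_ideal k P) (red_index P C 0) (red_mono k)"
    by (simp add: red_mono_def[abs_def])
next
  note J = fsubspace_rel_ideal[of k P]
  fix d g l assume g: "g \<in> span_mod (rel_ideal k P) (red_index P C d) (red_mono k)"
  show "(\<lambda>v. poly (lead_prod P) (v $ k) * g v) \<in> span_mod (rel_ideal k P) (red_index P C (Suc d)) (red_mono k)"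
    by (intro span_mod_mult[OF J g] red_step_lead C rel_ideal_mult polyf_poly polyf_var)
  show "(\<lambda>v. poly (lead_prod P) (v $ k) * v $ l * g v) \<in> span_mod (rel_ideal k P) (red_index P C (Suc d)) (red_mono k)"
    by (intro span_mod_mult[OF J g] red_step_coord C rel_ideal_mult polyf_mult polyf_poly polyf_var)
qed

section \<open>Affine curves and their tangent fields\<close>

definition lin :: "complex ^ 'n \<Rightarrow> complex ^ 'n \<Rightarrow> complex" where
  "lin a v = (\<Sum>i\<in>UNIV. a $ i * v $ i)"

lemma polyf_lin [simp]: "polyf (lin a)"
  unfolding lin_def[abs_def] by (intro polyf_intros)

lemma lin_right: "lin a (v + t *s h) = lin a v + t * lin a h"
  by (simp add: lin_def distrib_left sum.distrib sum_distrib_left mult_ac)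

lemma lin_add_left: "lin (a + b) v = lin a v + lin b v"
  and lin_diff_left: "lin (a - b) v = lin a v - lin b v"
  and lin_scale_left: "lin (c *s a) v = c * lin a v"
  by (simp_all add: lin_def distrib_right left_diff_distrib sum.distrib sum_subtractf sum_distrib_left mult.assoc)

section \<open>Clearing denominators and minimal relations\<close>

lemma clear_denominators_poly:
  assumes "polyf a" "polyf b"
  shows "\<exists>m g. polyf g \<and> (\<forall>v. b v \<noteq> 0 \<longrightarrow> g v = b v ^ m * poly c (a v / b v))"
proof (induction c)
  case 0
  show ?case by (intro exI[of _ 0] exI[of _ "\<lambda>_. 0"]) auto
next
  case (pCons c q)
  then obtain m g where g: "polyf g" "\<forall>v. b v \<noteq> 0 \<longrightarrow> g v = b v ^ m * poly q (a v / b v)" by blast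
  have "polyf (\<lambda>v. c * b v ^ Suc m + a v * g v)" by (intro polyf_intros assms g(1))
  then show ?case
    using g(2) by (intro exI[of _ "Suc m"] exI[of _ "\<lambda>v. c * b v ^ Suc m + a v * g v"]) (auto simp: field_simps)
qed

lemma clear_denominators:
  assumes "polyf a" "polyf b" "polyf q"
  shows "\<exists>m g. polyf g \<and> (\<forall>v. b v \<noteq> 0 \<longrightarrow> g v = b v ^ m * ev P (a v / b v) (q v))"
proof (induction P)
  case 0
  show ?case by (intro exI[of _ 0] exI[of _ "\<lambda>_. 0"]) auto
next
  case (pCons c P)
  then obtain m g where g: "polyf g" "\<forall>v. b v \<noteq> 0 \<longrightarrow> g v = b v ^ m * ev P (a v / b v) (q v)" by blast
  obtain n h where h: "polyf h" "\<forall>v. b v \<noteq> 0 \<longrightarrow> h v = b v ^ n * poly c (a v / b v)"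
    using clear_denominators_poly[OF assms(1,2)] by blast
  have "polyf (\<lambda>v. b v ^ m * h v + b v ^ n * (q v * g v))" by (intro polyf_intros assms g(1) h(1))
  then show ?case
    using g(2) h(2) by (intro exI[of _ "m + n"] exI[of _ "\<lambda>v. b v ^ m * h v + b v ^ n * (q v * g v)"])
      (auto simp: power_add algebra_simps)
qed

text \<open>Take a nonzero relation of least degree in the second argument. In characteristic 0 its
  derivative is nonzero and of smaller degree, so by minimality it is no relation; transcendence of
  \<open>r\<close> excludes degree 0.\<close>

lemma minimal_relation:
  assumes "P0 \<noteq> 0" "\<forall>v\<in>Z. ev P0 (r v) (q v) = 0"
    and transcendental: "\<And>c. c \<noteq> 0 \<Longrightarrow> \<exists>v\<in>Z. poly c (r v) \<noteq> 0"
  shows "\<exists>P. degree P > 0 \<and> (\<forall>v\<in>Z. ev P (r v) (q v) = 0) \<and> (\<exists>v\<in>Z. ev (pderiv P) (r v) (q v) \<noteq> 0)"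
proof -
  let ?Q = "\<lambda>P. P \<noteq> 0 \<and> (\<forall>v\<in>Z. ev P (r v) (q v) = 0)"
  obtain P where P: "?Q P" and min: "\<And>P'. ?Q P' \<Longrightarrow> degree P \<le> degree P'"
    using ex_has_least_nat[of ?Q P0 degree] assms(1,2) by blast
  have pos: "degree P > 0"
  proof (rule ccontr)
    assume "\<not> degree P > 0"
    then obtain c where c: "P = [:c:]" by (auto elim: degree_eq_zeroE)
    with P have "c \<noteq> 0" by auto
    from transcendental[OF this] P c show False by auto
  qed
  then have "pderiv P \<noteq> 0" "degree (pderiv P) < degree P" by (auto simp: pderiv_eq_0_iff degree_pderiv)
  with min[of "pderiv P"] have "\<exists>v\<in>Z. ev (pderiv P) (r v) (q v) \<noteq> 0" by auto
  with P pos show ?thesis by blast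
qed

text \<open>The assumption \<open>dependent\<close> says that the function field has transcendence degree at most one.\<close>

locale affine_curve =
  fixes Y :: "(complex ^ 'n) set"
  assumes nonempty: "Y \<noteq> {}"
    and prime: "\<lbrakk>polyf f; polyf g; \<forall>v\<in>Y. f v * g v = 0\<rbrakk> \<Longrightarrow> (\<forall>v\<in>Y. f v = 0) \<or> (\<forall>v\<in>Y. g v = 0)"
    and dependent: "\<lbrakk>polyf f; polyf h; polyf g; \<exists>v\<in>Y. g v \<noteq> 0\<rbrakk> \<Longrightarrow>
      \<exists>P. P \<noteq> 0 \<and> (\<forall>v\<in>Y. g v \<noteq> 0 \<longrightarrow> ev P (f v / g v) (h v / g v) = 0)"
    and nondegenerate: "\<forall>v\<in>Y. lin a v = 0 \<Longrightarrow> a = 0"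
begin

lemma prime_prod:
  assumes "finite I" "\<And>i. i \<in> I \<Longrightarrow> polyf (f i)" "\<forall>v\<in>Y. (\<Prod>i\<in>I. f i v) = 0"
  shows "\<exists>i\<in>I. \<forall>v\<in>Y. f i v = 0"
  using assms
proof (induction I rule: finite_induct)
  case empty
  then show ?case using nonempty by auto
next
  case (insert i I)
  have "(\<forall>v\<in>Y. f i v = 0) \<or> (\<forall>v\<in>Y. (\<Prod>i\<in>I. f i v) = 0)"
    using insert by (intro prime polyf_prod) simp_all
  with insert show ?case by blast
qed

text \<open>The ratio takes values among the finitely many roots \<rho> of \<open>c\<close>, so
  \<open>b\<close> times the product of all \<open>a - \<rho> * b\<close> vanishes on
  \<open>Y\<close>, and primeness singles out one root.\<close>

lemma algebraic_ratio_constant: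
  assumes "polyf a" "polyf b" "\<exists>v\<in>Y. b v \<noteq> 0" "c \<noteq> 0" "\<forall>v\<in>Y. b v \<noteq> 0 \<longrightarrow> poly c (a v / b v) = 0"
  shows "\<exists>\<rho>. \<forall>v\<in>Y. a v = \<rho> * b v"
proof -
  let ?R = "{\<rho>. poly c \<rho> = 0}"
  have fin: "finite ?R" using poly_roots_finite[OF assms(4)] .
  have p: "polyf (\<lambda>v. a v - \<rho> * b v)" for \<rho> by (intro polyf_intros assms)
  have "\<forall>v\<in>Y. b v * (\<Prod>\<rho>\<in>?R. a v - \<rho> * b v) = 0"
  proof
    fix v assume v: "v \<in> Y"
    show "b v * (\<Prod>\<rho>\<in>?R. a v - \<rho> * b v) = 0"
    proof (cases "b v = 0")
      case False
      then have "a v / b v \<in> ?R" "a v - (a v / b v) * b v = 0" using assms(5) v by auto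
      then show ?thesis using fin by (auto intro!: bexI[of _ "a v / b v"])
    qed simp
  qed
  from prime[OF assms(2) polyf_prod[OF p] this] assms(3)
  have "\<forall>v\<in>Y. (\<Prod>\<rho>\<in>?R. a v - \<rho> * b v) = 0" by blast
  from prime_prod[OF fin p this] show ?thesis by auto
qed

text \<open>The relation prescribed for \<open>k\<close> is \<open>y - x\<close>, which is trivially
  true there; with degree 1 and derivative 1 in \<open>y\<close>, it lets \<open>k\<close> be
  treated like any other coordinate. The last condition is separability along the curve.\<close>

definition adapted :: "'n \<Rightarrow> ('n \<Rightarrow> complex poly poly) \<Rightarrow> bool" where
  "adapted k P \<longleftrightarrow> (\<forall>c. \<exists>v\<in>Y. v $ k \<noteq> c) \<and> P k = [:[:0, -1:], 1:] \<and>
     (\<forall>i. degree (P i) > 0 \<and> (\<forall>v\<in>Y. rel k P i v = 0) \<and>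
        (\<exists>v\<in>Y. ev (pderiv (P i)) (v $ k) (v $ i) \<noteq> 0))"

lemma coordinate_transcendental:
  assumes "\<forall>c. \<exists>v\<in>Y. v $ k \<noteq> c" "c \<noteq> 0"
  shows "\<exists>v\<in>Y. poly c (v $ k) \<noteq> 0"
  using algebraic_ratio_constant[of "\<lambda>v. v $ k" "\<lambda>_. 1" c] assms nonempty by auto

lemma adapted_exists:
  assumes k: "\<forall>c. \<exists>v\<in>Y. v $ k \<noteq> c"
  shows "\<exists>P. adapted k P"
proof -
  have "\<exists>P. degree P > 0 \<and> (\<forall>v\<in>Y. ev P (v $ k) (v $ i) = 0) \<and> (\<exists>v\<in>Y. ev (pderiv P) (v $ k) (v $ i) \<noteq> 0) \<and>
      (i = k \<longrightarrow> P = [:[:0, -1:], 1:])" for i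
  proof (cases "i = k")
    case True
    then show ?thesis using nonempty by (intro exI[of _ "[:[:0, -1:], 1:]"]) (auto simp: pderiv_pCons)
  next
    case False
    obtain P0 where "P0 \<noteq> 0" "\<forall>v\<in>Y. ev P0 (v $ k) (v $ i) = 0"
      using dependent[of "\<lambda>v. v $ k" "\<lambda>v. v $ i" "\<lambda>_. 1"] nonempty by auto
    from minimal_relation[OF this coordinate_transcendental[OF k]] False show ?thesis by auto
  qed
  then obtain P where P: "\<And>i. degree (P i) > 0 \<and> (\<forall>v\<in>Y. ev (P i) (v $ k) (v $ i) = 0) \<and>
      (\<exists>v\<in>Y. ev (pderiv (P i)) (v $ k) (v $ i) \<noteq> 0) \<and> (i = k \<longrightarrow> P i = [:[:0, -1:], 1:])"
    by metis
  then have "adapted k P" unfolding adapted_def rel_def using k by blast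
  then show ?thesis by blast
qed

lemma lead_prod_nonzero:
  assumes "adapted k P"
  shows "lead_prod P \<noteq> 0"
proof -
  have "P i \<noteq> 0" for i using assms unfolding adapted_def by (metis degree_0 less_irrefl)
  then show ?thesis by (simp add: lead_prod_def)
qed

text \<open>The derivation with \<open>v $ k \<mapsto> \<Prod>\<^sub>j \<partial>\<^sub>y P\<^sub>j\<close> that annihilates every relation
  \<open>P\<^sub>i(v $ k, v $ i)\<close>, by implicit differentiation.\<close>

definition tangent_field :: "'n \<Rightarrow> ('n \<Rightarrow> complex poly poly) \<Rightarrow> complex ^ 'n \<Rightarrow> complex ^ 'n" where
  "tangent_field k P v = (\<chi> i. - ev (map_poly pderiv (P i)) (v $ k) (v $ i) *
     (\<Prod>j\<in>UNIV - {i}. ev (pderiv (P j)) (v $ k) (v $ j)))"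

lemma polyf_tangent_field: "polyf (\<lambda>v. tangent_field k P v $ i)"
  unfolding tangent_field_def by (simp add: polyf_mult polyf_minus polyf_prod polyf_ev)

lemma polyf_DD_tangent_field: "polyf f \<Longrightarrow> polyf (\<lambda>v. DD f v (tangent_field k P v))"
  by (intro polyf_DD polyf_tangent_field)

lemma tangent_field_base:
  assumes "adapted k P"
  shows "tangent_field k P v $ k = (\<Prod>j\<in>UNIV. ev (pderiv (P j)) (v $ k) (v $ j))"
proof -
  have "P k = [:[:0, -1:], 1:]" using assms by (simp add: adapted_def)
  then show ?thesis
    by (simp add: tangent_field_def prod.remove[of UNIV k] pderiv_pCons map_poly_pCons)
qed

text \<open>Both terms are, up to sign, the \<open>x\<close>-derivative of \<open>P i\<close> times
  the product of all \<open>y\<close>-derivatives, so they cancel on the whole space and not only on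
  \<open>Y\<close>. This is why the derivation maps \<open>rel_ideal\<close> into itself.\<close>

lemma DD_rel:
  assumes "adapted k P"
  shows "DD (rel k P i) v (tangent_field k P v) = 0"
proof -
  have "DD (rel k P i) v (tangent_field k P v) =
    ev (map_poly pderiv (P i)) (v $ k) (v $ i) * tangent_field k P v $ k +
    ev (pderiv (P i)) (v $ k) (v $ i) * tangent_field k P v $ i"
    unfolding rel_def[abs_def] by (simp add: DD_ev DD_coord)
  also have "\<dots> = 0"
    unfolding tangent_field_base[OF assms] by (simp add: tangent_field_def prod.remove[of UNIV i])
  finally show ?thesis .
qed

lemma polyf_rel: "polyf (rel k P i)"
  unfolding rel_def[abs_def] by (intro polyf_ev polyf_var)

lemma DD_rel_ideal:
  assumes "adapted k P" "f \<in> rel_ideal k P"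
  shows "(\<lambda>v. DD f v (tangent_field k P v)) \<in> rel_ideal k P"
proof -
  from assms(2) obtain h where h: "\<forall>i. polyf (h i)" "f = (\<lambda>v. \<Sum>i\<in>UNIV. h i v * rel k P i v)"
    by (auto simp: rel_ideal_def)
  have "DD f v (tangent_field k P v) = (\<Sum>i\<in>UNIV. DD (h i) v (tangent_field k P v) * rel k P i v)" for v
    unfolding h(2) using h(1) DD_rel[OF assms(1)]
    by (simp add: DD_sum polyf_mult polyf_rel DD_mult)
  with h(1) show ?thesis unfolding rel_ideal_def
    by (auto intro!: exI[of _ "\<lambda>i v. DD (h i) v (tangent_field k P v)"] polyf_DD_tangent_field)
qed

lemma rel_ideal_vanishes:
  assumes "adapted k P" "f \<in> rel_ideal k P" "v \<in> Y"
  shows "f v = 0"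
  using assms by (auto simp: rel_ideal_def adapted_def)

text \<open>Applying the derivation to \<open>G F\<^bsup>m+1\<^esup>\<close> and multiplying by \<open>G\<close> gives a multiple of \<open>F\<^sup>m\<close> in the
  ideal, with cofactor \<open>(m + 1) G\<^sup>2 DF\<close>.\<close>

lemma descent:
  assumes P: "adapted k P" and F: "polyf F" "\<exists>v\<in>Y. DD F v (tangent_field k P v) \<noteq> 0"
    and "polyf G" "(\<lambda>v. G v * F v ^ m) \<in> rel_ideal k P"
  shows "\<forall>v\<in>Y. G v = 0"
  using assms(4,5)
proof (induction m arbitrary: G)
  case 0
  then show ?case using rel_ideal_vanishes[OF P] by fastforce
next
  case (Suc m)
  define D where "D f v = DD f v (tangent_field k P v)" for f v
  have polyD: "polyf (D f)" if "polyf f" for f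
    unfolding D_def[abs_def] using that by (rule polyf_DD_tangent_field)
  define f where "f v = G v * F v ^ Suc m" for v
  have f: "f \<in> rel_ideal k P" "D f \<in> rel_ideal k P"
    using Suc.prems DD_rel_ideal[OF P] by (auto simp: f_def[abs_def] D_def[abs_def])
  have Df: "D f v = D G v * F v ^ Suc m + G v * (of_nat (Suc m) * F v ^ m * D F v)" for v
    unfolding D_def f_def[abs_def] using Suc.prems(1) F(1)
    by (subst DD_mult) (simp_all add: polyf_power DD_power_Suc del: power_Suc)
  have "(\<lambda>v. G v * D f v + (- 1) * (D G v * f v)) \<in> rel_ideal k P"
    using Suc.prems(1) f polyD
    by (intro fsubspace_add fsubspace_scale fsubspace_rel_ideal rel_ideal_mult) auto
  also have "(\<lambda>v. G v * D f v + (- 1) * (D G v * f v)) = (\<lambda>v. (of_nat (Suc m) * (G v * (G v * D F v))) * F v ^ m)"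
    unfolding Df f_def by (simp add: algebra_simps fun_eq_iff)
  finally have "\<forall>v\<in>Y. of_nat (Suc m) * (G v * (G v * D F v)) = 0"
    using Suc.prems(1) F(1) polyD by (intro Suc.IH polyf_mult polyf_const) auto
  then have "\<forall>v\<in>Y. G v * (G v * D F v) = 0" by (auto simp del: of_nat_Suc)
  then show ?case
    using prime[of G "\<lambda>v. G v * D F v"] prime[of G "D F"] Suc.prems(1) F polyD by (auto simp: D_def)
qed

text \<open>Over the field of rational functions in \<open>v $ k\<close>, the relations define a finite-dimensional
  algebra, so \<open>F\<close> is algebraic modulo the ideal they generate. Dividing the equation of \<open>F\<close> by the
  highest possible power of \<open>F\<close> leaves a cofactor whose constant term is nonzero.\<close>

lemma nilpotent_multiple:
  assumes P: "adapted k P" and F: "polyf F" "\<forall>v\<in>Y. F v = 0"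
  shows "\<exists>G m. polyf G \<and> (\<lambda>v. G v * F v ^ m) \<in> rel_ideal k P \<and> (\<exists>v\<in>Y. G v \<noteq> 0)"
proof -
  obtain \<delta> where \<delta>: "pf UNIV \<delta> F" using F polyf_def by blast
  obtain C where C: "red_bound P C" using red_bound_exists by blast
  \<comment> \<open>The \<open>(K + 1) * (L + 1)\<close> products \<open>v $ k ^ l * F v ^ a\<close>
    have degree at most \<open>d\<close> and must outnumber the \<open>(C * d + 1) * M\<close>
    reduced monomials. The choice \<open>K = C * M\<close> matches the growth in \<open>L\<close>,
    and \<open>L\<close> is the remaining constant, so the latter number is exactly
    \<open>K * L + L\<close>.\<close>
  define M where "M = (\<Prod>i\<in>UNIV. degree (P i))"
  define K where "K = C * M"
  define L where "L = (C * (K * \<delta>) + 1) * M"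
  define d where "d = L + K * \<delta>"
  let ?S = "{..K} \<times> {..L}"
  have "(C * d + 1) * M = K * L + L"
    unfolding d_def by (simp add: K_def L_def algebra_simps)
  then have card: "card (red_index P C d) < card ?S"
    unfolding card_red_index M_def[symmetric] by (simp add: card_cartesian_product)
  have elem: "(\<lambda>v. poly (lead_prod P) (v $ k) ^ d * (v $ k ^ l * F v ^ a)) \<in>
      span_mod (rel_ideal k P) (red_index P C d) (red_mono k)" if "a \<le> K" "l \<le> L" for a l
  proof -
    have "pf UNIV (l * Suc 0 + a * \<delta>) (\<lambda>v. v $ k ^ l * F v ^ a)"
      by (intro pf_mult pf_power pf_var \<delta>) simp
    moreover have "l * Suc 0 + a * \<delta> \<le> d"
      unfolding d_def using that by (simp add: add_mono)
    ultimately have "pf UNIV d (\<lambda>v. v $ k ^ l * F v ^ a)" by (rule pf_mono)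
    from red_pf[OF C _ this] P show ?thesis by (auto simp: adapted_def)
  qed
  have "\<exists>u. (\<exists>s\<in>?S. u s \<noteq> 0) \<and>
    (\<lambda>v. \<Sum>s\<in>?S. u s * (poly (lead_prod P) (v $ k) ^ d * (v $ k ^ snd s * F v ^ fst s))) \<in> rel_ideal k P"
    using span_mod_dependence[OF fsubspace_rel_ideal[of k P] _ finite_red_index card, where b = "red_mono k"
        and f = "\<lambda>s v. poly (lead_prod P) (v $ k) ^ d * (v $ k ^ snd s * F v ^ fst s)"] elem by auto
  then obtain u where u: "\<exists>s\<in>?S. u s \<noteq> 0"
    "(\<lambda>v. \<Sum>s\<in>?S. u s * (poly (lead_prod P) (v $ k) ^ d * (v $ k ^ snd s * F v ^ fst s))) \<in> rel_ideal k P"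
    by blast
  let ?N = "\<lambda>a. a \<le> K \<and> (\<exists>l\<le>L. u (a, l) \<noteq> 0)"
  define m where "m = (LEAST a. ?N a)"
  have "\<exists>a. ?N a" using u(1) by auto
  then have m: "?N m" unfolding m_def by (rule LeastI_ex)
  have zero: "u (a, l) = 0" if "a < m" "l \<le> L" for a l
    using not_less_Least[of a ?N] that m unfolding m_def by fastforce
  define G where "G v = poly (lead_prod P) (v $ k) ^ d * (\<Sum>a\<in>{m..K}. \<Sum>l\<le>L. u (a, l) * (v $ k ^ l * F v ^ (a - m)))" for v
  have "polyf G" unfolding G_def[abs_def]
    by (intro polyf_mult polyf_sum polyf_power polyf_poly polyf_var polyf_const F)
  moreover have "(\<lambda>v. G v * F v ^ m) \<in> rel_ideal k P"
  proof -
    have "(\<Sum>s\<in>?S. u s * (poly (lead_prod P) (v $ k) ^ d * (v $ k ^ snd s * F v ^ fst s))) = G v * F v ^ m" for v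
    proof -
      have "(\<Sum>s\<in>?S. u s * (poly (lead_prod P) (v $ k) ^ d * (v $ k ^ snd s * F v ^ fst s)))
        = (\<Sum>a\<le>K. \<Sum>l\<le>L. u (a, l) * (poly (lead_prod P) (v $ k) ^ d * (v $ k ^ l * F v ^ a)))"
        unfolding sum.cartesian_product by (simp add: case_prod_unfold)
      also have "\<dots> = (\<Sum>a\<in>{m..K}. \<Sum>l\<le>L. u (a, l) * (poly (lead_prod P) (v $ k) ^ d * (v $ k ^ l * F v ^ a)))"
        using zero by (intro sum.mono_neutral_right) auto
      also have "\<dots> = (\<Sum>a\<in>{m..K}. \<Sum>l\<le>L. poly (lead_prod P) (v $ k) ^ d * (u (a, l) * (v $ k ^ l * F v ^ (a - m))) * F v ^ m)"
      proof (intro sum.cong refl)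
        fix a l assume "a \<in> {m..K}"
        then have "F v ^ a = F v ^ (a - m) * F v ^ m" by (simp flip: power_add)
        then show "u (a, l) * (poly (lead_prod P) (v $ k) ^ d * (v $ k ^ l * F v ^ a)) =
          poly (lead_prod P) (v $ k) ^ d * (u (a, l) * (v $ k ^ l * F v ^ (a - m))) * F v ^ m"
          by (simp add: mult_ac)
      qed
      also have "\<dots> = G v * F v ^ m"
        by (simp add: G_def sum_distrib_left sum_distrib_right)
      finally show ?thesis .
    qed
    with u(2) show ?thesis by simp
  qed
  moreover have "\<exists>v\<in>Y. G v \<noteq> 0"
  proof -
    \<comment> \<open>On \<open>Y\<close>, where \<open>F\<close> is zero, only the term
      \<open>a = m\<close> of \<open>G\<close> survives. It is a nonzero polynomial in
      \<open>v $ k\<close>, which is transcendental, so \<open>G\<close> is nonzero somewhere on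
      \<open>Y\<close>.\<close>
    define c where "c = (\<Sum>l\<le>L. monom (u (m, l)) l)"
    have "c \<noteq> 0"
    proof -
      obtain l where l: "l \<le> L" "u (m, l) \<noteq> 0" using m by blast
      have "coeff c l = u (m, l)" unfolding c_def coeff_sum using l by (simp add: coeff_monom)
      with l show ?thesis by auto
    qed
    then have "lead_prod P ^ d * c \<noteq> 0" using lead_prod_nonzero[OF P] by simp
    moreover have "\<forall>c. \<exists>v\<in>Y. v $ k \<noteq> c" using P by (simp add: adapted_def)
    ultimately obtain v where v: "v \<in> Y" "poly (lead_prod P ^ d * c) (v $ k) \<noteq> 0"
      using coordinate_transcendental by blast
    have "(\<Sum>a\<in>{m..K}. \<Sum>l\<le>L. u (a, l) * (v $ k ^ l * F v ^ (a - m))) = (\<Sum>a\<in>{m}. \<Sum>l\<le>L. u (a, l) * (v $ k ^ l * F v ^ (a - m)))"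
    proof (intro sum.mono_neutral_right ballI sum.neutral)
      fix a l assume "a \<in> {m..K} - {m}"
      then show "u (a, l) * (v $ k ^ l * F v ^ (a - m)) = 0" using F(2) v(1) by (simp add: power_0_left)
    qed (use m in auto)
    also have "\<dots> = poly c (v $ k)" by (simp add: c_def poly_sum poly_monom)
    finally have "G v = poly (lead_prod P ^ d * c) (v $ k)" by (simp add: G_def)
    with v(2) have "G v \<noteq> 0" by metis
    with v(1) show ?thesis by blast
  qed
  ultimately show ?thesis by blast
qed

lemma tangent:
  assumes "adapted k P" "polyf F" "\<forall>v\<in>Y. F v = 0" "v \<in> Y"
  shows "DD F v (tangent_field k P v) = 0"
proof (rule ccontr)
  assume "DD F v (tangent_field k P v) \<noteq> 0"
  with assms(4) have *: "\<exists>v\<in>Y. DD F v (tangent_field k P v) \<noteq> 0" by blast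
  obtain G m where "polyf G" "(\<lambda>v. G v * F v ^ m) \<in> rel_ideal k P" "\<exists>v\<in>Y. G v \<noteq> 0"
    using nilpotent_multiple[OF assms(1-3)] by blast
  with descent[OF assms(1,2) *] show False by blast
qed

text \<open>\<open>W\<close> says that \<open>lin a / lin b\<close> has zero derivative along the
  field. If this ratio were not constant, it would be transcendental and \<open>v $ k\<close>
  algebraic over it; differentiating a minimal equation makes the derivative of \<open>v $ k\<close>
  vanish on \<open>Y\<close>. But that derivative is the product of the \<open>y\<close>-derivatives
  of the relations, none of which vanishes identically on \<open>Y\<close>.\<close>

lemma wronskian:
  assumes P: "adapted k P" and b: "b \<noteq> 0"
    and W: "\<forall>v\<in>Y. lin a v * lin b (tangent_field k P v) = lin b v * lin a (tangent_field k P v)"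
  shows "\<exists>\<rho>. a = \<rho> *s b"
proof (rule ccontr)
  assume indep: "\<not> ?thesis"
  have b_nz: "\<exists>v\<in>Y. lin b v \<noteq> 0" using nondegenerate b by blast
  let ?Z = "{v\<in>Y. lin b v \<noteq> 0}"
  let ?r = "\<lambda>v. lin a v / lin b v"
  \<comment> \<open>This numerator writes \<open>v $ k\<close> as a fraction over
    \<open>lin b v\<close>, the common denominator that \<open>dependent\<close> asks for.\<close>
  have "polyf (\<lambda>v. v $ k * lin b v)" by (intro polyf_intros polyf_lin)
  from dependent[OF polyf_lin this polyf_lin b_nz, of a] obtain P0 where
    "P0 \<noteq> 0" "\<forall>v\<in>?Z. ev P0 (?r v) (v $ k) = 0" by auto
  moreover have "\<exists>v\<in>?Z. poly c (?r v) \<noteq> 0" if c: "c \<noteq> 0" for c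
  proof (rule ccontr)
    assume "\<not> ?thesis"
    then have "\<forall>v\<in>Y. lin b v \<noteq> 0 \<longrightarrow> poly c (?r v) = 0" by blast
    from algebraic_ratio_constant[OF polyf_lin polyf_lin b_nz c this] obtain \<rho> where
      "\<forall>v\<in>Y. lin a v = \<rho> * lin b v" by blast
    then have "a - \<rho> *s b = 0" by (intro nondegenerate) (simp add: lin_diff_left lin_scale_left)
    with indep show False by auto
  qed
  ultimately obtain Q where Q: "\<forall>v\<in>?Z. ev Q (?r v) (v $ k) = 0" "\<exists>v\<in>?Z. ev (pderiv Q) (?r v) (v $ k) \<noteq> 0"
    using minimal_relation[of P0 ?Z ?r "\<lambda>v. v $ k"] by blast
  obtain m g where g: "polyf g" "\<forall>v. lin b v \<noteq> 0 \<longrightarrow> g v = lin b v ^ m * ev Q (?r v) (v $ k)"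
    using clear_denominators[OF polyf_lin[of a] polyf_lin[of b] polyf_var[of k], of Q] by blast
  obtain n h where h: "polyf h" "\<forall>v. lin b v \<noteq> 0 \<longrightarrow> h v = lin b v ^ n * ev (pderiv Q) (?r v) (v $ k)"
    using clear_denominators[OF polyf_lin[of a] polyf_lin[of b] polyf_var[of k], of "pderiv Q"] by blast
  \<comment> \<open>The extra factor \<open>lin b v\<close> makes \<open>F\<close> vanish also where
    the ratio is undefined, so that \<open>tangent\<close> applies.\<close>
  define F where "F v = lin b v * g v" for v
  have F: "polyf F" unfolding F_def[abs_def] by (intro polyf_intros polyf_lin g(1))
  have "\<forall>v\<in>Y. F v = 0"
  proof
    fix v assume "v \<in> Y"
    then show "F v = 0" using Q(1) g(2) by (cases "lin b v = 0") (auto simp: F_def)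
  qed
  note DF = tangent[OF P F this]
  have key: "ev (pderiv Q) (?r v) (v $ k) * tangent_field k P v $ k = 0" if v: "v \<in> ?Z" for v
  proof -
    let ?w = "tangent_field k P v"
    have r: "((\<lambda>t. lin a (v + t *s ?w) / lin b (v + t *s ?w)) has_field_derivative 0) (at 0)"
    proof -
      have "lin a ?w * lin b v - lin a v * lin b ?w = 0" using W v by (simp add: mult.commute)
      then show ?thesis unfolding lin_right using v
        by (auto intro!: derivative_eq_intros)
    qed
    have kk: "((\<lambda>t. (v + t *s ?w) $ k) has_field_derivative ?w $ k) (at 0)"
      by (auto intro!: derivative_eq_intros)
    have lb: "((\<lambda>t. lin b (v + t *s ?w)) has_field_derivative lin b ?w) (at 0)"
      unfolding lin_right by (auto intro!: derivative_eq_intros)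
    \<comment> \<open>In the product rule the derivative of the power meets \<open>ev Q\<close>,
      which is zero at \<open>v\<close>, and the ratio has derivative 0 by \<open>r\<close>; only
      the second argument of \<open>Q\<close> contributes.\<close>
    let ?c = "lin b v ^ Suc m * (ev (pderiv Q) (?r v) (v $ k) * ?w $ k)"
    have 1: "((\<lambda>t. lin b (v + t *s ?w) ^ Suc m * ev Q (lin a (v + t *s ?w) / lin b (v + t *s ?w)) ((v + t *s ?w) $ k))
        has_field_derivative ?c) (at 0)"
      by (rule DERIV_cong[OF DERIV_mult[OF DERIV_power[OF lb] ev_field_derivative[OF r kk]]])
        (use v Q(1) in simp)
    have "open {t. lin b (v + t *s ?w) \<noteq> 0}"
      unfolding lin_right by (intro open_Collect_neq continuous_intros)
    then have 2: "eventually (\<lambda>t. t \<in> {t. lin b (v + t *s ?w) \<noteq> 0}) (nhds 0)"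
      using v by (intro eventually_nhds_in_open) auto
    have "eventually (\<lambda>t. lin b (v + t *s ?w) ^ Suc m * ev Q (lin a (v + t *s ?w) / lin b (v + t *s ?w)) ((v + t *s ?w) $ k)
        = F (v + t *s ?w)) (nhds 0)"
      using 2 by eventually_elim (use g(2) in \<open>simp add: F_def\<close>)
    from DERIV_cong_ev[OF refl this refl] 1
    have "((\<lambda>t. F (v + t *s ?w)) has_field_derivative ?c) (at 0)" by blast
    from DD_eqI[OF this] DF[of v] v show ?thesis by simp
  qed
  have "\<forall>v\<in>Y. lin b v * (h v * tangent_field k P v $ k) = 0"
  proof
    fix v assume "v \<in> Y"
    then show "lin b v * (h v * tangent_field k P v $ k) = 0"
      using key[of v] h(2) by (cases "lin b v = 0") (auto simp: mult.assoc)
  qed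
  then have "(\<forall>v\<in>Y. lin b v = 0) \<or> (\<forall>v\<in>Y. h v * tangent_field k P v $ k = 0)"
    by (intro prime polyf_lin polyf_mult h polyf_tangent_field)
  with b_nz have "\<forall>v\<in>Y. h v * tangent_field k P v $ k = 0" by blast
  then have "(\<forall>v\<in>Y. h v = 0) \<or> (\<forall>v\<in>Y. tangent_field k P v $ k = 0)"
    by (intro prime h polyf_tangent_field)
  moreover have "\<exists>v\<in>Y. h v \<noteq> 0"
  proof -
    obtain v where "v \<in> Y" "lin b v \<noteq> 0" "ev (pderiv Q) (?r v) (v $ k) \<noteq> 0" using Q(2) by blast
    then have "h v \<noteq> 0" using h(2) by simp
    with \<open>v \<in> Y\<close> show ?thesis by blast
  qed
  ultimately have "\<forall>v\<in>Y. (\<Prod>j\<in>UNIV. ev (pderiv (P j)) (v $ k) (v $ j)) = 0"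
    using tangent_field_base[OF P] by auto
  then have "\<exists>j\<in>UNIV. \<forall>v\<in>Y. ev (pderiv (P j)) (v $ k) (v $ j) = 0"
    by (intro prime_prod polyf_ev polyf_var finite)
  with P show False unfolding adapted_def by blast
qed

section \<open>Sums of points of an affine curve\<close>

text \<open>If every coordinate had a constant value \<open>c\<close>, the form with coefficients
  \<open>c j\<close> at \<open>i\<close> and \<open>- c i\<close> at \<open>j\<close> would vanish
  on \<open>Y\<close>, hence \<open>c i = 0\<close>, and then the coordinate \<open>i\<close> would
  vanish on \<open>Y\<close>. With a single coordinate, \<open>Y\<close> may be one point.\<close>

lemma nonconstant_coordinate:
  fixes i j :: 'n
  assumes "i \<noteq> j"
  shows "\<exists>k. \<forall>c. \<exists>v\<in>Y. v $ k \<noteq> c"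
proof (rule ccontr)
  assume "\<not> ?thesis"
  then have "\<forall>k. \<exists>c. \<forall>v\<in>Y. v $ k = c" by blast
  then obtain c where c: "\<And>k v. v \<in> Y \<Longrightarrow> v $ k = c k" by metis
  have lin_axis: "lin (axis k x) v = x * v $ k" for k x v
    by (simp add: lin_def axis_def if_distrib[of "\<lambda>x. x * _"] cong: if_cong)
  have "axis i (c j) - axis j (c i) = (0 :: complex ^ 'n)"
    by (intro nondegenerate) (simp add: lin_diff_left lin_axis c)
  then have "(axis i (c j) - axis j (c i) :: complex ^ 'n) $ j = 0" by simp
  then have "c i = 0" using assms by (simp add: axis_def)
  then have "axis i 1 = (0 :: complex ^ 'n)"
    by (intro nondegenerate) (simp add: lin_axis c)
  then show False by simp
qed

subsection \<open>Algebraic dependence by counting\<close>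

text \<open>A pair \<open>(\<tau>, y)\<close> stands for the point \<open>\<tau> y\<close> of the cone over \<open>Y\<close>. Up to a common denominator,
  polynomials of degree \<open>d\<close> in a sum of \<open>s\<close> such points span a space of dimension \<open>O(d\<^bsup>2s\<^esup>)\<close>, while
  there are of order \<open>d\<^bsup>2s+1\<^esup>\<close> monomials of degree \<open>d\<close> in \<open>2s + 1\<close> variables.\<close>

definition pair_index :: "('n \<Rightarrow> complex poly poly) \<Rightarrow> nat \<Rightarrow> nat \<Rightarrow> (nat \<times> nat \<times> ('n \<Rightarrow> nat)) set" where
  "pair_index P C d = {..d} \<times> red_index P C d"

definition pair_mono :: "'n \<Rightarrow> nat \<times> nat \<times> ('n \<Rightarrow> nat) \<Rightarrow> complex \<times> (complex ^ 'n) \<Rightarrow> complex" where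
  "pair_mono k t x = fst x ^ fst t * red_mono k (snd t) (snd x)"

definition pair_vanishing :: "(complex \<times> (complex ^ 'n) \<Rightarrow> complex) set" where
  "pair_vanishing = {f. \<forall>\<tau>. \<forall>y\<in>Y. f (\<tau>, y) = 0}"

abbreviation "pair_span k P C d \<equiv> span_mod pair_vanishing (pair_index P C d) (pair_mono k)"

lemma fsubspace_pair_vanishing: "fsubspace pair_vanishing"
  by (auto simp: fsubspace_def pair_vanishing_def)

lemma finite_pair_index: "finite (pair_index P C d)"
  by (simp add: pair_index_def finite_red_index)

text \<open>A reduction on the curve becomes one on the cone after multiplication by a power of the
  scalar, because members of \<open>rel_ideal\<close> vanish on \<open>Y\<close>.\<close>

lemma pair_span_lift:
  assumes P: "adapted k P" and f: "f \<in> span_mod (rel_ideal k P) (red_index P C d) (red_mono k)" and \<alpha>: "\<alpha> \<le> d"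
  shows "(\<lambda>x. fst x ^ \<alpha> * f (snd x)) \<in> pair_span k P C d"
proof -
  note J = fsubspace_pair_vanishing
  note sub = fsubspace_span_mod[OF J]
  from f obtain c where c: "(\<lambda>v. f v - (\<Sum>t\<in>red_index P C d. c t * red_mono k t v)) \<in> rel_ideal k P"
    by (auto simp: span_mod_def)
  have "(\<lambda>x. \<Sum>t\<in>red_index P C d. c t * pair_mono k (\<alpha>, t) x) \<in> pair_span k P C d"
    using \<alpha> by (intro fsubspace_sum[OF sub] fsubspace_scale[OF sub] span_mod_base J finite_pair_index)
      (auto simp: pair_index_def)
  moreover have "(\<lambda>x. fst x ^ \<alpha> * (f (snd x) - (\<Sum>t\<in>red_index P C d. c t * red_mono k t (snd x)))) \<in> pair_span k P C d"
    using rel_ideal_vanishes[OF P c] by (intro span_mod_ideal) (auto simp: pair_vanishing_def)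
  ultimately have "(\<lambda>x. (\<Sum>t\<in>red_index P C d. c t * pair_mono k (\<alpha>, t) x) +
      fst x ^ \<alpha> * (f (snd x) - (\<Sum>t\<in>red_index P C d. c t * red_mono k t (snd x)))) \<in> pair_span k P C d"
    by (rule fsubspace_add[OF sub])
  also have "(\<lambda>x. (\<Sum>t\<in>red_index P C d. c t * pair_mono k (\<alpha>, t) x) +
      fst x ^ \<alpha> * (f (snd x) - (\<Sum>t\<in>red_index P C d. c t * red_mono k t (snd x))))
    = (\<lambda>x. fst x ^ \<alpha> * f (snd x))"
    by (simp add: pair_mono_def right_diff_distrib sum_distrib_left mult.left_commute)
  finally show ?thesis .
qed

lemma pair_step_lead:
  assumes P: "adapted k P" "red_bound P C" and t: "t \<in> pair_index P C d"
  shows "(\<lambda>x. poly (lead_prod P) (snd x $ k) * pair_mono k t x) \<in> pair_span k P C (Suc d)"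
proof -
  have "(\<lambda>x. fst x ^ fst t * (poly (lead_prod P) (snd x $ k) * red_mono k (snd t) (snd x))) \<in> pair_span k P C (Suc d)"
    using t by (intro pair_span_lift[OF P(1)] red_step_lead P) (auto simp: pair_index_def)
  then show ?thesis by (simp add: pair_mono_def mult.left_commute)
qed

lemma pair_step_coord:
  assumes P: "adapted k P" "red_bound P C" and t: "t \<in> pair_index P C d"
  shows "(\<lambda>x. poly (lead_prod P) (snd x $ k) * (fst x * snd x $ l) * pair_mono k t x) \<in> pair_span k P C (Suc d)"
proof -
  have "(\<lambda>x. fst x ^ Suc (fst t) * (poly (lead_prod P) (snd x $ k) * snd x $ l * red_mono k (snd t) (snd x))) \<in> pair_span k P C (Suc d)"
    using t by (intro pair_span_lift[OF P(1)] red_step_coord P) (auto simp: pair_index_def)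
  then show ?thesis by (simp add: pair_mono_def mult_ac)
qed

section \<open>Tuples of scaled points and their sums\<close>

definition tuple_index :: "('n \<Rightarrow> complex poly poly) \<Rightarrow> nat \<Rightarrow> nat \<Rightarrow> nat \<Rightarrow> (nat \<Rightarrow> nat \<times> nat \<times> ('n \<Rightarrow> nat)) set" where
  "tuple_index P C s d = (\<Pi>\<^sub>E i\<in>{..<s}. pair_index P C d)"

definition tuple_mono :: "'n \<Rightarrow> nat \<Rightarrow> (nat \<Rightarrow> nat \<times> nat \<times> ('n \<Rightarrow> nat)) \<Rightarrow> (nat \<Rightarrow> complex \<times> (complex ^ 'n)) \<Rightarrow> complex" where
  "tuple_mono k s T x = (\<Prod>i<s. pair_mono k (T i) (x i))"

definition tuple_vanishing :: "nat \<Rightarrow> ((nat \<Rightarrow> complex \<times> (complex ^ 'n)) \<Rightarrow> complex) set" where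
  "tuple_vanishing s = {f. \<forall>x. (\<forall>i<s. snd (x i) \<in> Y) \<longrightarrow> f x = 0}"

abbreviation "tuple_span k P C s d \<equiv> span_mod (tuple_vanishing s) (tuple_index P C s d) (tuple_mono k s)"

lemma fsubspace_tuple_vanishing: "fsubspace (tuple_vanishing s)"
  by (auto simp: fsubspace_def tuple_vanishing_def)

lemma finite_tuple_index: "finite (tuple_index P C s d)"
  unfolding tuple_index_def by (intro finite_PiE finite_pair_index finite_lessThan)

lemma card_tuple_index:
  "card (tuple_index P C s d) = ((d + 1) * ((C * d + 1) * (\<Prod>i\<in>UNIV. degree (P i)))) ^ s"
  by (simp add: tuple_index_def card_PiE pair_index_def card_cartesian_product card_red_index)

text \<open>Expanding a product of sums: functions of separate points combine as in a tensor
  product, which is where the exponent \<open>s\<close> in the dimension bound comes from.\<close>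

lemma tuple_span_prod:
  assumes "\<And>i. i < s \<Longrightarrow> f i \<in> pair_span k P C d"
  shows "(\<lambda>x. \<Prod>i<s. f i (x i)) \<in> tuple_span k P C s d"
proof -
  have "\<forall>i\<in>{..<s}. \<exists>c. (\<lambda>v. f i v - (\<Sum>t\<in>pair_index P C d. c t * pair_mono k t v)) \<in> pair_vanishing"
    using assms by (auto simp: span_mod_def)
  then obtain c where c: "\<And>i. i < s \<Longrightarrow> (\<lambda>v. f i v - (\<Sum>t\<in>pair_index P C d. c i t * pair_mono k t v)) \<in> pair_vanishing"
    unfolding bchoice_iff by auto
  have "(\<Prod>i<s. f i (x i)) = (\<Sum>T\<in>tuple_index P C s d. (\<Prod>i<s. c i (T i)) * tuple_mono k s T x)"
    if "\<forall>i<s. snd (x i) \<in> Y" for x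
  proof -
    have "f i (x i) = (\<Sum>t\<in>pair_index P C d. c i t * pair_mono k t (x i))" if "i < s" for i
    proof -
      have "f i (fst (x i), snd (x i)) - (\<Sum>t\<in>pair_index P C d. c i t * pair_mono k t (fst (x i), snd (x i))) = 0"
        using c[OF that] \<open>\<forall>i<s. snd (x i) \<in> Y\<close> that unfolding pair_vanishing_def by blast
      then show ?thesis by simp
    qed
    then have "(\<Prod>i<s. f i (x i)) = (\<Prod>i<s. \<Sum>t\<in>pair_index P C d. c i t * pair_mono k t (x i))"
      by (intro prod.cong) auto
    also have "\<dots> = (\<Sum>T\<in>tuple_index P C s d. \<Prod>i<s. c i (T i) * pair_mono k (T i) (x i))"
      unfolding tuple_index_def by (rule prod_sum_PiE) (auto simp: finite_pair_index)
    finally show ?thesis by (simp add: tuple_mono_def prod.distrib)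
  qed
  then have "(\<lambda>x. (\<Prod>i<s. f i (x i)) - (\<Sum>T\<in>tuple_index P C s d. (\<Prod>i<s. c i (T i)) * tuple_mono k s T x))
      \<in> tuple_vanishing s"
    unfolding tuple_vanishing_def by simp
  then show ?thesis unfolding span_mod_def mem_Collect_eq by (rule exI[of _ "\<lambda>T. \<Prod>i<s. c i (T i)"])
qed

definition tuple_sum :: "nat \<Rightarrow> (nat \<Rightarrow> complex \<times> (complex ^ 'n)) \<Rightarrow> complex ^ 'n" where
  "tuple_sum s x = (\<Sum>i<s. fst (x i) *s snd (x i))"

definition tuple_lead :: "'n \<Rightarrow> ('n \<Rightarrow> complex poly poly) \<Rightarrow> nat \<Rightarrow> (nat \<Rightarrow> complex \<times> (complex ^ 'n)) \<Rightarrow> complex" where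
  "tuple_lead k P s x = (\<Prod>i<s. poly (lead_prod P) (snd (x i) $ k))"

lemma tuple_step_lead:
  assumes P: "adapted k P" "red_bound P C" and T: "T \<in> tuple_index P C s d"
  shows "(\<lambda>x. tuple_lead k P s x * tuple_mono k s T x) \<in> tuple_span k P C s (Suc d)"
proof -
  have "(\<lambda>x. \<Prod>i<s. poly (lead_prod P) (snd (x i) $ k) * pair_mono k (T i) (x i)) \<in> tuple_span k P C s (Suc d)"
    using T by (intro tuple_span_prod pair_step_lead P) (auto simp: tuple_index_def)
  then show ?thesis by (simp add: tuple_lead_def tuple_mono_def prod.distrib)
qed

lemma tuple_step_coord:
  assumes P: "adapted k P" "red_bound P C" and T: "T \<in> tuple_index P C s d"
  shows "(\<lambda>x. tuple_lead k P s x * tuple_sum s x $ l * tuple_mono k s T x) \<in> tuple_span k P C s (Suc d)"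
proof -
  note sub = fsubspace_span_mod[OF fsubspace_tuple_vanishing]
  \<comment> \<open>\<open>m j\<close> inserts the coordinate of the \<open>j\<close>-th summand
    into the \<open>j\<close>-th factor only, so each term of \<open>tuple_sum\<close> becomes a
    product over the points.\<close>
  define m where "m j i x = (if i = j then fst x * snd x $ l else 1)" for i j :: nat and x :: "complex \<times> (complex ^ 'n)"
  have "(\<lambda>x. \<Sum>j<s. \<Prod>i<s. poly (lead_prod P) (snd (x i) $ k) * m j i (x i) * pair_mono k (T i) (x i)) \<in> tuple_span k P C s (Suc d)"
  proof (intro fsubspace_sum[OF sub] tuple_span_prod)
    fix i j assume "i < s"
    then have "T i \<in> pair_index P C d" using T by (auto simp: tuple_index_def)
    then show "(\<lambda>x. poly (lead_prod P) (snd x $ k) * m j i x * pair_mono k (T i) x) \<in> pair_span k P C (Suc d)"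
      using pair_step_lead[OF P] pair_step_coord[OF P] by (cases "i = j") (auto simp: m_def)
  qed
  moreover have "(\<Sum>j<s. \<Prod>i<s. poly (lead_prod P) (snd (x i) $ k) * m j i (x i) * pair_mono k (T i) (x i))
    = tuple_lead k P s x * tuple_sum s x $ l * tuple_mono k s T x" for x
  proof -
    have "(\<Prod>i<s. m j i (x i)) = fst (x j) * snd (x j) $ l" if "j < s" for j
      using that by (simp add: m_def)
    then show ?thesis
      by (simp add: prod.distrib tuple_lead_def tuple_mono_def tuple_sum_def sum_distrib_left sum_distrib_right)
  qed
  ultimately show ?thesis by simp
qed

lemma tuple_span_pf:
  assumes P: "adapted k P" "red_bound P C" and f: "pf UNIV d f"
  shows "(\<lambda>x. tuple_lead k P s x ^ d * f (tuple_sum s x)) \<in> tuple_span k P C s d"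
proof (rule pf_growth[OF _ _ _ _ f])
  note J = fsubspace_tuple_vanishing[of s]
  show "fsubspace (tuple_span k P C s d)" for d by (rule fsubspace_span_mod[OF J])
  have "pair_mono k (0, 0, \<lambda>_. 0) \<in> pair_span k P C 0"
    using P(1) by (intro span_mod_base fsubspace_pair_vanishing finite_pair_index)
      (auto simp: pair_index_def red_index_def adapted_def)
  then have "(\<lambda>x. \<Prod>i<s. pair_mono k (0, 0, \<lambda>_. 0) (x i)) \<in> tuple_span k P C s 0"
    by (intro tuple_span_prod)
  then show "(\<lambda>_. 1) \<in> tuple_span k P C s 0" by (simp add: pair_mono_def red_mono_def)
next
  note J = fsubspace_tuple_vanishing[of s]
  fix d g l assume g: "g \<in> tuple_span k P C s d"
  show "(\<lambda>x. tuple_lead k P s x * g x) \<in> tuple_span k P C s (Suc d)"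
    by (rule span_mod_mult[OF J g tuple_step_lead[OF P]]) (auto simp: tuple_vanishing_def)
  show "(\<lambda>x. tuple_lead k P s x * tuple_sum s x $ l * g x) \<in> tuple_span k P C s (Suc d)"
    by (rule span_mod_mult[OF J g tuple_step_coord[OF P]]) (auto simp: tuple_vanishing_def)
qed

lemma tuple_sum_update: "j < s \<Longrightarrow> tuple_sum s (x(j := p)) = (\<Sum>i\<in>{..<s} - {j}. fst (x i) *s snd (x i)) + fst p *s snd p"
  unfolding tuple_sum_def by (simp add: sum.remove[of "{..<s}" j] add.commute)

lemma polyf_tuple_sum_update:
  assumes "polyf f" "j < s"
  shows "polyf (\<lambda>v. f (tuple_sum s (x(j := (\<tau>, v)))))"
  unfolding tuple_sum_update[OF assms(2)]
  by (rule polyf_compose[OF assms(1)]) (simp add: polyf_add polyf_mult)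

text \<open>Primeness speaks of one point, so the factors of \<open>tuple_lead\<close> are removed
  singly, from the last one down, with the other points frozen. Each factor is nonzero somewhere on
  \<open>Y\<close> by transcendence of \<open>v $ k\<close>.\<close>

lemma tuple_lead_cancel:
  assumes P: "adapted k P" and f: "polyf f"
    and zero: "\<And>x. \<forall>i<s. snd (x i) \<in> Y \<Longrightarrow> tuple_lead k P s x * f (tuple_sum s x) = 0"
    and x: "\<forall>i<s. snd (x i) \<in> Y"
  shows "f (tuple_sum s x) = 0"
proof -
  have "m \<le> s \<Longrightarrow> \<forall>x. (\<forall>i<s. snd (x i) \<in> Y) \<longrightarrow> tuple_lead k P m x * f (tuple_sum s x) = 0" for m
  proof (induction rule: inc_induct)
    case base
    show ?case using zero by blast
  next
    case (step m)
    show ?case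
    proof (intro allI impI)
      fix x :: "nat \<Rightarrow> complex \<times> (complex ^ 'n)" assume x: "\<forall>i<s. snd (x i) \<in> Y"
      define x' where "x' v = x(m := (fst (x m), v))" for v
      let ?G = "\<lambda>v. tuple_lead k P m x * f (tuple_sum s (x' v))"
      have "\<forall>v\<in>Y. poly (lead_prod P) (v $ k) * ?G v = 0"
      proof
        fix v assume "v \<in> Y"
        then have "\<forall>i<s. snd (x' v i) \<in> Y" using x by (simp add: x'_def)
        with step.IH have "tuple_lead k P (Suc m) (x' v) * f (tuple_sum s (x' v)) = 0" by blast
        moreover have "tuple_lead k P (Suc m) (x' v) = tuple_lead k P m x * poly (lead_prod P) (v $ k)"
          by (simp add: tuple_lead_def x'_def)
        ultimately show "poly (lead_prod P) (v $ k) * ?G v = 0" by auto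
      qed
      moreover have "polyf (\<lambda>v. poly (lead_prod P) (v $ k))" by (intro polyf_poly polyf_var)
      moreover have "polyf ?G" unfolding x'_def using f step.hyps
        by (intro polyf_mult polyf_const polyf_tuple_sum_update) auto
      moreover have "\<exists>v\<in>Y. poly (lead_prod P) (v $ k) \<noteq> 0"
        using coordinate_transcendental[of k "lead_prod P"] lead_prod_nonzero[OF P] P by (simp add: adapted_def)
      ultimately have "\<forall>v\<in>Y. ?G v = 0" using prime by blast
      moreover have "x' (snd (x m)) = x" by (simp add: x'_def)
      moreover have "snd (x m) \<in> Y" using x step.hyps by simp
      ultimately show "tuple_lead k P m x * f (tuple_sum s x) = 0" by metis
    qed
  qed
  from this[of 0] x show ?thesis by (simp add: tuple_lead_def)
qed

text \<open>For the degree \<open>(2 * s + 1) * q\<close>, the left side is the size of the tuple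
  span, and the right side counts monomials in \<open>2 * s + 1\<close> variables with exponents
  below \<open>q\<close>. The left side is at most \<open>\<kappa> ^ s * q ^ (2 * s)\<close>, so any
  \<open>q\<close> above \<open>\<kappa> ^ s\<close> works.\<close>

lemma counting_bound:
  fixes s C M :: nat
  shows "\<exists>q. (((2 * s + 1) * q + 1) * ((C * ((2 * s + 1) * q) + 1) * M)) ^ s < q ^ (2 * s + 1)"
proof -
  let ?a = "2 * s + 1"
  define \<kappa> where "\<kappa> = (?a + 1) * ((C * ?a + 1) * M)"
  define q where "q = \<kappa> ^ s + 1"
  have "(?a * q + 1) \<le> (?a + 1) * q" "C * (?a * q) + 1 \<le> (C * ?a + 1) * q"
    by (simp_all add: q_def algebra_simps)
  then have "(?a * q + 1) * ((C * (?a * q) + 1) * M) \<le> ((?a + 1) * q) * (((C * ?a + 1) * q) * M)"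
    by (intro mult_le_mono) auto
  also have "\<dots> = \<kappa> * q ^ 2" by (simp add: \<kappa>_def power2_eq_square algebra_simps)
  finally have "((?a * q + 1) * ((C * (?a * q) + 1) * M)) ^ s \<le> (\<kappa> * q ^ 2) ^ s" by (rule power_mono) simp
  also have "\<dots> = \<kappa> ^ s * q ^ (2 * s)" by (simp add: power_mult_distrib power_mult)
  also have "\<dots> < q * q ^ (2 * s)" by (intro mult_strict_right_mono) (auto simp: q_def)
  finally show ?thesis by (intro exI[of _ q]) simp
qed

lemma dependent_sums:
  assumes "card E > 2 * s" "s \<ge> 1"
  shows "\<exists>p\<in>polys_in E. p \<noteq> 0 \<and> (\<forall>x. (\<forall>i<s. snd (x i) \<in> Y) \<longrightarrow> peval p (($) (tuple_sum s x)) = 0)"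
proof -
  have "2 * s + 1 \<le> card E" using assms(1) by simp
  from obtain_subset_with_card_n[OF this] obtain E' where E': "E' \<subseteq> E" "card E' = 2 * s + 1"
    by blast
  \<comment> \<open>Two distinct indices, available because \<open>s \<ge> 1\<close>, ensure that
    some coordinate is nonconstant.\<close>
  obtain i j where "i \<in> E'" "j \<in> E'" "i \<noteq> j"
  proof -
    have "\<not> card E' \<le> 1" using E'(2) assms(2) by simp
    then have "\<not> (\<forall>i\<in>E'. \<forall>j\<in>E'. i = j)" by (simp add: card_le_Suc0_iff_eq)
    then show ?thesis using that by blast
  qed
  from nonconstant_coordinate[OF this(3)] obtain k where "\<forall>c. \<exists>v\<in>Y. v $ k \<noteq> c" ..
  from adapted_exists[OF this] obtain P where P: "adapted k P" ..
  obtain C where C: "red_bound P C" using red_bound_exists by blast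
  obtain q where q: "(((2 * s + 1) * q + 1) * ((C * ((2 * s + 1) * q) + 1) * (\<Prod>i\<in>UNIV. degree (P i)))) ^ s
      < q ^ (2 * s + 1)"
    using counting_bound[of s C "\<Prod>i\<in>UNIV. degree (P i)"] ..
  define d where "d = (2 * s + 1) * q"
  have count: "((d + 1) * ((C * d + 1) * (\<Prod>i\<in>UNIV. degree (P i)))) ^ s < q ^ (2 * s + 1)"
    using q unfolding d_def .
  let ?S = "\<Pi>\<^sub>E i\<in>E'. {..<q}"
  define f where "f e v = (\<Prod>i\<in>E'. v $ i ^ e i)" for e :: "'n \<Rightarrow> nat" and v :: "complex ^ 'n"
  have finS: "finite ?S" by (intro finite_PiE) auto
  have card: "card (tuple_index P C s d) < card ?S"
    unfolding card_tuple_index using count E'(2) by (simp add: card_PiE)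
  have "(\<lambda>x. tuple_lead k P s x ^ d * f e (tuple_sum s x)) \<in> tuple_span k P C s d" if "e \<in> ?S" for e
  proof (rule tuple_span_pf[OF P C])
    have "pf UNIV (\<Sum>i\<in>E'. e i * Suc 0) (f e)"
      unfolding f_def[abs_def] by (intro pf_prod pf_power pf_var) auto
    moreover have "(\<Sum>i\<in>E'. e i * Suc 0) \<le> d"
    proof -
      have "e i \<le> q" if "i \<in> E'" for i using PiE_mem[OF \<open>e \<in> ?S\<close> that] by simp
      then show ?thesis using sum_bounded_above[of E' e q] by (simp add: d_def E'(2))
    qed
    ultimately show "pf UNIV d (f e)" by (rule pf_mono)
  qed
  from span_mod_dependence[OF fsubspace_tuple_vanishing finS finite_tuple_index card,
      where f = "\<lambda>e x. tuple_lead k P s x ^ d * f e (tuple_sum s x)", OF this] obtain u where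
    u: "\<exists>e\<in>?S. u e \<noteq> 0"
    "(\<lambda>x. \<Sum>e\<in>?S. u e * (tuple_lead k P s x ^ d * f e (tuple_sum s x))) \<in> tuple_vanishing s"
    by auto
  define mo where "mo e = Abs_poly_mapping (\<lambda>i. if i \<in> E' then e i else 0)" for e :: "'n \<Rightarrow> nat"
  have mo: "Poly_Mapping.lookup (mo e) i = (if i \<in> E' then e i else 0)" for e i
    unfolding mo_def by (subst Abs_poly_mapping_inverse) auto
  have keys_mo: "Poly_Mapping.keys (mo e) \<subseteq> E'" for e by (auto simp: in_keys_iff mo split: if_splits)
  have mo_inj: "e = e'" if "e \<in> ?S" "e' \<in> ?S" "mo e = mo e'" for e e'
  proof (rule PiE_ext[OF that(1,2)])
    fix i assume "i \<in> E'"
    then show "e i = e' i" using mo[of e i] mo[of e' i] that(3) by simp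
  qed
  define p where "p = (\<Sum>e\<in>?S. Poly_Mapping.single (mo e) (u e))"
  have peval_p: "peval p (($) v) = (\<Sum>e\<in>?S. u e * f e v)" for v
  proof -
    have "mono_eval (mo e) (($) v) = f e v" for e
      unfolding f_def by (subst mono_eval_superset[OF _ keys_mo]) (auto simp: mo intro: prod.cong)
    then show ?thesis by (simp add: p_def peval_sum peval_single)
  qed
  have "p \<in> polys_in E"
    using keys_sum[of "\<lambda>e. Poly_Mapping.single (mo e) (u e)" ?S] keys_mo E'(1)
    unfolding p_def polys_in_def by (fastforce split: if_splits)
  moreover have "p \<noteq> 0"
  proof -
    obtain e where e: "e \<in> ?S" "u e \<noteq> 0" using u(1) by blast
    have "Poly_Mapping.lookup p (mo e) = (\<Sum>e'\<in>?S. if e' = e then u e' else 0)"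
      unfolding p_def lookup_sum using mo_inj e(1) by (intro sum.cong) (auto simp: lookup_single when_def)
    also have "\<dots> = u e" using e finS by simp
    finally show ?thesis using e(2) by auto
  qed
  moreover have "peval p (($) (tuple_sum s x)) = 0" if x: "\<forall>i<s. snd (x i) \<in> Y" for x
  proof (rule tuple_lead_cancel[OF P _ _ x])
    show "polyf (\<lambda>v. peval p (($) v))"
      unfolding peval_p f_def by (intro polyf_intros)
    fix x :: "nat \<Rightarrow> complex \<times> (complex ^ 'n)" assume "\<forall>i<s. snd (x i) \<in> Y"
    with u(2) have "(\<Sum>e\<in>?S. u e * (tuple_lead k P s x ^ d * f e (tuple_sum s x))) = 0"
      by (simp add: tuple_vanishing_def)
    then have "tuple_lead k P s x ^ d * peval p (($) (tuple_sum s x)) = 0"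
      unfolding peval_p by (simp add: sum_distrib_left mult.left_commute)
    then show "tuple_lead k P s x * peval p (($) (tuple_sum s x)) = 0" by auto
  qed
  ultimately show ?thesis by blast
qed

subsection \<open>Algebraic independence by Terracini's lemma\<close>

text \<open>If all coordinates are constant, there is only one of them; any form is then a multiple
  of a given nonzero one, and the zero field has the required properties.\<close>

lemma tangent_field_exists:
  "\<exists>w. (\<forall>i. polyf (\<lambda>v. w v $ i)) \<and>
     (\<forall>F. polyf F \<longrightarrow> (\<forall>v\<in>Y. F v = 0) \<longrightarrow> (\<forall>v\<in>Y. DD F v (w v) = 0)) \<and>
     (\<forall>a b. b \<noteq> 0 \<longrightarrow> (\<forall>v\<in>Y. lin a v * lin b (w v) = lin b v * lin a (w v)) \<longrightarrow> (\<exists>\<rho>. a = \<rho> *s b))"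
proof (cases "\<exists>k. \<forall>c. \<exists>v\<in>Y. v $ k \<noteq> c")
  case True
  then obtain k where "\<forall>c. \<exists>v\<in>Y. v $ k \<noteq> c" ..
  from adapted_exists[OF this] obtain P where P: "adapted k P" ..
  show ?thesis
  proof (intro exI[of _ "tangent_field k P"] conjI allI impI ballI)
    show "DD F v (tangent_field k P v) = 0" if "polyf F" "\<forall>v\<in>Y. F v = 0" "v \<in> Y" for F v
      using tangent[OF P that] .
    show "\<exists>\<rho>. a = \<rho> *s b" if "b \<noteq> 0"
      "\<forall>v\<in>Y. lin a v * lin b (tangent_field k P v) = lin b v * lin a (tangent_field k P v)" for a b
      using wronskian[OF P that] .
  qed (rule polyf_tangent_field)
next
  case False
  have one: "i = j" for i j :: 'n using nonconstant_coordinate[of i j] False by blast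
  have "\<exists>\<rho>. a = \<rho> *s b" if b: "b \<noteq> 0" for a b :: "complex ^ 'n"
  proof -
    obtain i where i: "b $ i \<noteq> 0" using b by (auto simp: vec_eq_iff)
    have "a = (a $ i / b $ i) *s b"
      unfolding vec_eq_iff using i one by (metis nonzero_eq_divide_eq vector_smult_component)
    then show ?thesis ..
  qed
  moreover have "DD F v 0 = 0" if "polyf F" for F :: "complex ^ 'n \<Rightarrow> complex" and v
    by (rule DD_eqI) simp
  ultimately show ?thesis by (intro exI[of _ "\<lambda>_. 0"]) simp
qed

lemma vec_dim_psubset:
  fixes S T :: "(complex ^ 'm) set"
  assumes "vec.subspace S" "vec.subspace T" "S \<subset> T"
  shows "vec.dim S < vec.dim T"
  using assms by (intro vec.dim_psubset) (simp add: vec.span_eq_iff[THEN iffD2])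

lemma subspace_lin: "vec.subspace {a. lin a v = 0}"
  by (auto simp: vec.subspace_def lin_add_left lin_scale_left) (simp add: lin_def)

text \<open>A generic point and its tangent direction impose two independent conditions on a space of
  linear forms: if \<open>a\<close> and \<open>b\<close> are independent forms, then \<open>a(v) b - b(v) a\<close> vanishes at \<open>v\<close> but
  not at the tangent vector.\<close>

lemma dim_drop:
  assumes w: "\<And>i. polyf (\<lambda>v. w v $ i)"
    and wronskian: "\<And>a b. b \<noteq> 0 \<Longrightarrow> \<forall>v\<in>Y. lin a v * lin b (w v) = lin b v * lin a (w v) \<Longrightarrow> \<exists>\<rho>. a = \<rho> *s b"
    and A: "vec.subspace A" and H: "polyf H" "\<exists>v\<in>Y. H v \<noteq> 0"
  shows "\<exists>v\<in>Y. H v \<noteq> 0 \<and> vec.dim {a\<in>A. lin a v = 0 \<and> lin a (w v) = 0} \<le> vec.dim A - 2"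
proof -
  \<comment> \<open>The cases are dimension 0, 1 and at least 2. Truncated subtraction turns the
    bound into 0 in the first two.\<close>
  consider "A \<subseteq> {0}" | b where "b \<in> A" "b \<noteq> 0" "A \<subseteq> range (\<lambda>\<rho>. \<rho> *s b)"
    | a b where "a \<in> A" "b \<in> A" "b \<noteq> 0" "\<nexists>\<rho>. a = \<rho> *s b"
    by blast
  then show ?thesis
  proof cases
    case 1
    obtain v where v: "v \<in> Y" "H v \<noteq> 0" using H(2) by blast
    have "{a\<in>A. lin a v = 0 \<and> lin a (w v) = 0} \<subseteq> {0}" using 1 by blast
    then have "vec.dim {a\<in>A. lin a v = 0 \<and> lin a (w v) = 0} = 0" by (simp only: vec.dim_eq_0)
    then have "vec.dim {a\<in>A. lin a v = 0 \<and> lin a (w v) = 0} \<le> vec.dim A - 2" by linarith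
    then show ?thesis using v by blast
  next
    case 2
    have "\<not> (\<forall>v\<in>Y. H v * lin b v = 0)"
      using prime[OF H(1) polyf_lin, of b] H(2) nondegenerate[of b] 2(2) by blast
    then obtain v where v: "v \<in> Y" "H v \<noteq> 0" "lin b v \<noteq> 0" by auto
    have "{a\<in>A. lin a v = 0 \<and> lin a (w v) = 0} \<subseteq> {0}"
      using 2(3) v(3) by (auto simp: lin_scale_left)
    then have "vec.dim {a\<in>A. lin a v = 0 \<and> lin a (w v) = 0} = 0" by (simp only: vec.dim_eq_0)
    then have "vec.dim {a\<in>A. lin a v = 0 \<and> lin a (w v) = 0} \<le> vec.dim A - 2" by linarith
    then show ?thesis using v by blast
  next
    case 3
    let ?W = "\<lambda>v. lin a v * lin b (w v) - lin b v * lin a (w v)"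
    have "polyf (\<lambda>v. lin c (w v))" for c
      by (rule polyf_compose[OF polyf_lin w])
    then have W: "polyf ?W" by (intro polyf_intros polyf_lin)
    have "\<not> (\<forall>v\<in>Y. ?W v = 0)" using wronskian[OF 3(3)] 3(4) by auto
    then have "\<not> (\<forall>v\<in>Y. H v * ?W v = 0)" using prime[OF H(1) W] H(2) by blast
    then obtain v where v: "v \<in> Y" "H v \<noteq> 0" "?W v \<noteq> 0" by auto
    let ?A1 = "{a\<in>A. lin a v = 0}" and ?A2 = "{a\<in>A. lin a v = 0 \<and> lin a (w v) = 0}"
    have "vec.subspace (A \<inter> {a. lin a v = 0})"
      by (intro vec.subspace_inter A subspace_lin)
    moreover have "A \<inter> {a. lin a v = 0} = ?A1" by blast
    ultimately have A1: "vec.subspace ?A1" by simp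
    have "vec.subspace (?A1 \<inter> {a. lin a (w v) = 0})"
      by (intro vec.subspace_inter A1 subspace_lin)
    moreover have "?A1 \<inter> {a. lin a (w v) = 0} = ?A2" by blast
    ultimately have A2: "vec.subspace ?A2" by simp
    let ?c = "lin a v *s b - lin b v *s a"
    have "?c \<in> A" using 3(1,2) by (intro vec.subspace_diff vec.subspace_scale A)
    moreover have "lin ?c v = 0" "lin ?c (w v) \<noteq> 0"
      using v(3) by (simp_all add: lin_diff_left lin_scale_left)
    ultimately have "?A2 \<subset> ?A1" by blast
    from vec_dim_psubset[OF A2 A1 this] have "vec.dim ?A2 < vec.dim ?A1" .
    moreover have "lin a v \<noteq> 0 \<or> lin b v \<noteq> 0" using v(3) by auto
    then have "?A1 \<subset> A" using 3(1,2) by blast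
    from vec_dim_psubset[OF A1 A this] have "vec.dim ?A1 < vec.dim A" .
    ultimately have "vec.dim ?A2 \<le> vec.dim A - 2" by linarith
    then show ?thesis using v by blast
  qed
qed

lemma dim_supported:
  fixes E :: "'n set"
  shows "vec.dim {a :: complex ^ 'n. \<forall>i. i \<notin> E \<longrightarrow> a $ i = 0} \<le> card E"
proof -
  have "{a :: complex ^ 'n. \<forall>i. i \<notin> E \<longrightarrow> a $ i = 0} \<subseteq> vec.span ((\<lambda>i. axis i 1) ` E)"
  proof
    fix a :: "complex ^ 'n" assume a: "a \<in> {a. \<forall>i. i \<notin> E \<longrightarrow> a $ i = 0}"
    have "a = (\<Sum>i\<in>UNIV. a $ i *s axis i 1)" by (simp add: basis_expansion)
    also have "\<dots> = (\<Sum>i\<in>E. a $ i *s axis i 1)"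
      using a by (intro sum.mono_neutral_right) auto
    also have "\<dots> \<in> vec.span ((\<lambda>i. axis i 1) ` E)"
      by (intro vec.span_sum vec.span_scale vec.span_base) auto
    finally show "a \<in> vec.span ((\<lambda>i. axis i 1) ` E)" .
  qed
  then have "vec.dim {a :: complex ^ 'n. \<forall>i. i \<notin> E \<longrightarrow> a $ i = 0} \<le> card ((\<lambda>i. axis i (1::complex)) ` E :: (complex ^ 'n) set)"
    by (intro vec.dim_le_card) auto
  also have "\<dots> \<le> card E" by (rule card_image_le) simp
  finally show ?thesis .
qed

text \<open>A small common shift \<epsilon> of all scalars makes each of them nonzero and, by
  continuity, keeps the value nonzero. Tangency at the \<open>i\<close>-th point yields an equation
  multiplied by \<open>fst (x i)\<close>, which has to be cancelled.\<close>

lemma nonzero_scalars: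
  assumes f: "polyf f" and x: "f (tuple_sum s x) \<noteq> 0"
  shows "\<exists>x'. (\<forall>i. snd (x' i) = snd (x i)) \<and> (\<forall>i<s. fst (x' i) \<noteq> 0) \<and> f (tuple_sum s x') \<noteq> 0"
proof -
  define x' where "x' \<epsilon> i = (fst (x i) + \<epsilon>, snd (x i))" for \<epsilon> i
  define h where "h = (\<Sum>i<s. snd (x i))"
  have x': "tuple_sum s (x' \<epsilon>) = tuple_sum s x + \<epsilon> *s h" for \<epsilon>
    by (simp add: tuple_sum_def x'_def h_def vec.scale_left_distrib vec.scale_sum_right sum.distrib)
  have "isCont (\<lambda>\<epsilon>. f (tuple_sum s x + \<epsilon> *s h)) 0"
    using DD_field_derivative[OF f] by (rule DERIV_isCont)
  then have "((\<lambda>\<epsilon>. f (tuple_sum s (x' \<epsilon>))) \<longlongrightarrow> f (tuple_sum s x)) (at 0)"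
    unfolding x' isCont_def by simp
  then have "eventually (\<lambda>\<epsilon>. f (tuple_sum s (x' \<epsilon>)) \<noteq> 0) (at 0)"
    using x by (rule tendsto_imp_eventually_ne)
  moreover have "eventually (\<lambda>\<epsilon>. \<forall>i\<in>{..<s}. fst (x' \<epsilon> i) \<noteq> 0) (at 0)"
  proof (intro eventually_ball_finite ballI finite_lessThan)
    fix i
    have "((\<lambda>\<epsilon>. fst (x i) + \<epsilon>) \<longlongrightarrow> fst (x i) + 0) (at 0)" by (intro tendsto_intros)
    then show "eventually (\<lambda>\<epsilon>. fst (x' \<epsilon> i) \<noteq> 0) (at 0)"
      using tendsto_imp_eventually_ne[of "\<lambda>\<epsilon>. fst (x i) + \<epsilon>" "fst (x i)" "at 0" 0] eventually_neq_at_within[of 0 0 UNIV]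
      by (cases "fst (x i) = 0") (simp_all add: x'_def)
  qed
  ultimately have "eventually (\<lambda>\<epsilon>. f (tuple_sum s (x' \<epsilon>)) \<noteq> 0 \<and> (\<forall>i\<in>{..<s}. fst (x' \<epsilon> i) \<noteq> 0)) (at 0)"
    by (rule eventually_conj)
  then obtain \<epsilon> where "f (tuple_sum s (x' \<epsilon>)) \<noteq> 0" "\<forall>i\<in>{..<s}. fst (x' \<epsilon> i) \<noteq> 0"
    using eventually_happens[of _ "at (0::complex)"] trivial_limit_at by blast
  then show ?thesis by (intro exI[of _ "x' \<epsilon>"]) (auto simp: x'_def)
qed

text \<open>Once the partial derivatives are shown to vanish on all sums, the induction hypothesis
  makes them zero everywhere. Then \<open>f\<close> is constant, and the sum with zero scalars shows
  that the constant is 0.\<close>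

lemma independent_sums:
  assumes "card E \<le> 2 * s" "pf E d f" "\<And>x. \<forall>i<s. snd (x i) \<in> Y \<Longrightarrow> f (tuple_sum s x) = 0"
  shows "f v = 0"
  using assms(2,3)
proof (induction d arbitrary: f v rule: less_induct)
  case (less d)
  have f: "polyf f" using less.prems(1) by (rule pf_imp_polyf)
  from pf_gradient[OF less.prems(1)] obtain g where
    g: "\<And>i. if d = 0 then g i = (\<lambda>_. 0) else pf E (d - 1) (g i)" "\<And>i. i \<notin> E \<Longrightarrow> g i = (\<lambda>_. 0)"
    "\<And>v h t. ((\<lambda>t. f (v + t *s h)) has_field_derivative (\<Sum>i\<in>UNIV. g i (v + t *s h) * h $ i)) (at t)"
    by blast
  have grad: "DD f v h = lin (\<chi> i. g i v) h" for v h
    using DD_eqI[OF g(3)[of v h 0]] by (simp add: lin_def)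
  have polyg: "polyf (g i)" for i
    using g(1)[of i] pf_imp_polyf[of E "d - 1" "g i"] by (cases "d = 0") simp_all
  have g0: "g e (tuple_sum s x) = 0" if x: "\<forall>i<s. snd (x i) \<in> Y" for e x
  proof (rule ccontr)
    assume "g e (tuple_sum s x) \<noteq> 0"
    from nonzero_scalars[OF polyg this] obtain x1 where
      x1: "\<forall>i<s. snd (x1 i) \<in> Y" "\<forall>i<s. fst (x1 i) \<noteq> 0" "g e (tuple_sum s x1) \<noteq> 0"
      using x by metis
    obtain w where w: "\<And>i. polyf (\<lambda>v. w v $ i)"
      and tang: "\<And>F v. polyf F \<Longrightarrow> \<forall>v\<in>Y. F v = 0 \<Longrightarrow> v \<in> Y \<Longrightarrow> DD F v (w v) = 0"
      and wron: "\<And>a b. b \<noteq> 0 \<Longrightarrow> \<forall>v\<in>Y. lin a v * lin b (w v) = lin b v * lin a (w v) \<Longrightarrow> \<exists>\<rho>. a = \<rho> *s b"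
      using tangent_field_exists by metis
    \<comment> \<open>Forms that the first \<open>m\<close> points still admit as gradient of
      \<open>f\<close> at the sum.\<close>
    define Ann where "Ann m x = {a. (\<forall>i. i \<notin> E \<longrightarrow> a $ i = 0) \<and>
      (\<forall>i<m. lin a (snd (x i)) = 0 \<and> lin a (w (snd (x i))) = 0)}" for m :: nat and x :: "nat \<Rightarrow> complex \<times> (complex ^ 'n)"
    have subAnn: "vec.subspace (Ann m x)" for m x
      unfolding Ann_def vec.subspace_def
      by (auto simp: lin_add_left lin_scale_left) (simp_all add: lin_def)
    \<comment> \<open>Points are exchanged one at a time for generic ones, each lowering the
      dimension by two. Keeping \<open>g e\<close> nonzero at the sum is the polynomial condition
      \<open>H\<close> passed to \<open>dim_drop\<close>.\<close>
    have "m \<le> s \<Longrightarrow> \<exists>x. (\<forall>i<s. snd (x i) \<in> Y) \<and> (\<forall>i<s. fst (x i) \<noteq> 0) \<and> g e (tuple_sum s x) \<noteq> 0 \<and>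
        vec.dim (Ann m x) \<le> card E - 2 * m" for m
    proof (induction m)
      case 0
      show ?case using x1 dim_supported[of E] by (intro exI[of _ x1]) (simp add: Ann_def)
    next
      case (Suc m)
      then obtain x where x: "\<forall>i<s. snd (x i) \<in> Y" "\<forall>i<s. fst (x i) \<noteq> 0" "g e (tuple_sum s x) \<noteq> 0"
        "vec.dim (Ann m x) \<le> card E - 2 * m" by auto
      define x' where "x' v = x(m := (fst (x m), v))" for v
      have "m < s" using Suc.prems by simp
      have "polyf (\<lambda>v. g e (tuple_sum s (x' v)))"
        unfolding x'_def by (intro polyf_tuple_sum_update polyg \<open>m < s\<close>)
      moreover have "\<exists>v\<in>Y. g e (tuple_sum s (x' v)) \<noteq> 0"
        using x \<open>m < s\<close> by (intro bexI[of _ "snd (x m)"]) (simp_all add: x'_def)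
      ultimately obtain v where v: "v \<in> Y" "g e (tuple_sum s (x' v)) \<noteq> 0"
        "vec.dim {a\<in>Ann m x. lin a v = 0 \<and> lin a (w v) = 0} \<le> vec.dim (Ann m x) - 2"
        using dim_drop[of w "Ann m x" "\<lambda>v. g e (tuple_sum s (x' v))", OF w wron subAnn] by blast
      have "Ann (Suc m) (x' v) = {a\<in>Ann m x. lin a v = 0 \<and> lin a (w v) = 0}"
        by (auto simp: Ann_def x'_def less_Suc_eq)
      then have "vec.dim (Ann (Suc m) (x' v)) \<le> card E - 2 * Suc m" using v(3) x(4) by simp
      moreover have "\<forall>i<s. snd (x' v i) \<in> Y" "\<forall>i<s. fst (x' v i) \<noteq> 0"
        using x(1,2) v(1) \<open>m < s\<close> by (auto simp: x'_def)
      ultimately show ?case using v(2) by blast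
    qed
    from this[of s] obtain x where x: "\<forall>i<s. snd (x i) \<in> Y" "\<forall>i<s. fst (x i) \<noteq> 0" "g e (tuple_sum s x) \<noteq> 0"
      "vec.dim (Ann s x) \<le> card E - 2 * s" by auto
    define a where "a = (\<chi> i. g i (tuple_sum s x))"
    have "lin a (snd (x i)) = 0 \<and> lin a (w (snd (x i))) = 0" if i: "i < s" for i
    proof
      \<comment> \<open>With the other points fixed, \<open>f\<close> as a function of the
        \<open>i\<close>-th point vanishes on \<open>Y\<close>, so its derivative along
        \<open>w\<close> is zero.\<close>
      define F where "F v = f (tuple_sum s (x(i := (fst (x i), v))))" for v
      have F0: "F v = 0" if "v \<in> Y" for v
        unfolding F_def using x(1) that by (intro less.prems(2)) auto
      have DF: "DD F (snd (x i)) h = fst (x i) * lin a h" for h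
      proof (rule DD_eqI)
        have *: "F (snd (x i) + t *s h) = f (tuple_sum s x + t *s (fst (x i) *s h))" for t
        proof -
          have "tuple_sum s (x(i := (fst (x i), snd (x i) + t *s h))) =
            tuple_sum s (x(i := (fst (x i), snd (x i)))) + t *s (fst (x i) *s h)"
            unfolding tuple_sum_update[OF i] by (simp add: vec.scale_right_distrib mult.commute)
          then show ?thesis by (simp add: F_def)
        qed
        show "((\<lambda>t. F (snd (x i) + t *s h)) has_field_derivative fst (x i) * lin a h) (at 0)"
          unfolding * using g(3)[of "tuple_sum s x" "fst (x i) *s h" 0]
          by (simp add: a_def lin_def sum_distrib_left mult.left_commute)
      qed
      have "DD F (snd (x i)) (w (snd (x i))) = 0"
        unfolding F_def using x(1) i F0[unfolded F_def]
        by (intro tang polyf_tuple_sum_update f) auto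
      then show "lin a (w (snd (x i))) = 0" using DF x(2) i by simp
      \<comment> \<open>The direction of the point itself comes from varying its scalar, along which
        \<open>f\<close> is identically zero.\<close>
      have "((\<lambda>t. f (tuple_sum s x + t *s snd (x i))) has_field_derivative lin a (snd (x i))) (at 0)"
        using g(3)[of "tuple_sum s x" "snd (x i)" 0] by (simp add: a_def lin_def)
      moreover have "f (tuple_sum s x + t *s snd (x i)) = 0" for t
      proof -
        have "tuple_sum s x + t *s snd (x i) = tuple_sum s (x(i := (fst (x i), snd (x i)))) + t *s snd (x i)" by simp
        also have "\<dots> = tuple_sum s (x(i := (fst (x i) + t, snd (x i))))"
          unfolding tuple_sum_update[OF i] by (simp add: vec.scale_left_distrib)
        finally show ?thesis using x(1) by (simp add: less.prems(2))
      qed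
      ultimately have "((\<lambda>t. 0) has_field_derivative lin a (snd (x i))) (at 0)" by simp
      then show "lin a (snd (x i)) = 0" by (metis DERIV_unique DERIV_const)
    qed
    moreover have "\<forall>i. i \<notin> E \<longrightarrow> a $ i = 0" using g(2) by (simp add: a_def)
    ultimately have "a \<in> Ann s x" by (simp add: Ann_def)
    moreover have "vec.dim (Ann s x) = 0" using x(4) assms(1) by simp
    ultimately have "a = 0" unfolding vec.dim_eq_0 by blast
    then have "a $ e = 0" by simp
    with x(3) show False by (simp add: a_def)
  qed
  have "g i = (\<lambda>_. 0)" for i
  proof (cases "d = 0")
    case False
    show ?thesis
    proof
      fix v show "g i v = 0"
        using less.IH[of "d - 1" "g i" v] False g(1)[of i] g0 by simp
    qed
  qed (use g(1) in simp)
  then have "((\<lambda>t. f (0 + t *s v)) has_field_derivative 0) (at t)" for t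
    using g(3)[of 0 v t] by simp
  then have "\<exists>c. \<forall>t\<in>UNIV. f (0 + t *s v) = c"
    by (intro has_field_derivative_zero_constant convex_UNIV)
  then have "f (0 + 1 *s v) = f (0 + 0 *s v)" by (metis UNIV_I)
  moreover have "f 0 = 0"
  proof -
    obtain y where "y \<in> Y" using nonempty by blast
    then show ?thesis using less.prems(2)[of "\<lambda>_. (0, y)"] by (simp add: tuple_sum_def)
  qed
  ultimately show ?case by simp
qed

end

section \<open>Projective curves\<close>

lemma proj_space_scale: "L \<in> proj_space \<Longrightarrow> v \<in> L \<Longrightarrow> c *s v \<in> L"
  by (auto simp: proj_space_def)

lemma irreducible_subset_proj_space: "irreducible_proj_variety X \<Longrightarrow> X \<subseteq> proj_space"
  by (auto simp: irreducible_proj_variety_def proj_closed_def)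

lemma affine_cone_scale:
  assumes "X \<subseteq> proj_space" "v \<in> affine_cone X"
  shows "c *s v \<in> affine_cone X"
  using assms proj_space_scale unfolding affine_cone_def by fastforce

lemma irreducible_forms:
  fixes X :: "(complex ^ 'n) set set"
  assumes X: "irreducible_proj_variety X" and p: "homogeneous d p" and q: "homogeneous e q"
    and pq: "\<forall>v\<in>affine_cone X. peval p (($) v) = 0 \<or> peval q (($) v) = 0"
  shows "(\<forall>v\<in>affine_cone X. peval p (($) v) = 0) \<or> (\<forall>v\<in>affine_cone X. peval q (($) v) = 0)"
proof -
  define V where "V r = {L \<in> proj_space. \<forall>p\<in>{r}. \<forall>v\<in>L. peval p (($) v) = 0}" for r :: "'n cpoly"
  have "proj_closed (V p)" "proj_closed (V q)"
    unfolding proj_closed_def V_def using p q by blast+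
  moreover have "X \<subseteq> V p \<union> V q"
  proof
    fix L assume L: "L \<in> X"
    then have "L \<in> proj_space" using irreducible_subset_proj_space[OF X] by blast
    then obtain v where v: "L = range (\<lambda>c. c *s v)" by (auto simp: proj_space_def)
    have "1 *s v \<in> L" unfolding v by (rule rangeI)
    then have "v \<in> affine_cone X" using L by (auto simp: affine_cone_def)
    with pq \<open>L \<in> proj_space\<close> show "L \<in> V p \<union> V q"
      by (auto simp: V_def v peval_homogeneous[OF p] peval_homogeneous[OF q])
  qed
  ultimately have "X \<subseteq> V p \<or> X \<subseteq> V q"
    using X unfolding irreducible_proj_variety_def by blast
  moreover have "\<forall>v\<in>affine_cone X. peval r (($) v) = 0" if r: "X \<subseteq> V r" for r
  proof -
    \<comment> \<open>The inserted origin already lies on every line of \<open>X\<close>, so the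
      cone is the union of its lines.\<close>
    obtain L where L: "L \<in> X" "L \<in> proj_space"
      using X irreducible_subset_proj_space[OF X] by (auto simp: irreducible_proj_variety_def)
    then obtain v where "v \<in> L" by (auto simp: proj_space_def)
    from proj_space_scale[OF L(2) this, of 0] have "0 \<in> L" by simp
    with L(1) have "affine_cone X = \<Union>X" by (auto simp: affine_cone_def)
    with r show ?thesis by (auto simp: V_def)
  qed
  ultimately show ?thesis by blast
qed

text \<open>The product of \<open>p\<close> with the coordinate \<open>k\<close> vanishes on the
  whole cone, and the coordinate does not, so irreducibility leaves \<open>p\<close>.\<close>

lemma form_times_coordinate:
  fixes X :: "(complex ^ 'n) set set"
  assumes "irreducible_proj_variety X" "homogeneous d p"
    and k: "\<exists>v\<in>affine_cone X. v $ k \<noteq> 0"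
    and p: "\<forall>v\<in>affine_cone X. v $ k \<noteq> 0 \<longrightarrow> peval p (($) v) = 0"
  shows "\<forall>v\<in>affine_cone X. peval p (($) v) = 0"
proof -
  have "homogeneous 0 (1 :: 'n cpoly)" using homogeneous_single[of "0 :: 'n \<Rightarrow>\<^sub>0 nat" 0 1] by simp
  moreover have "peval (1 :: 'n cpoly) x = 1" for x
    using peval_single[of "0 :: 'n \<Rightarrow>\<^sub>0 nat" 1 x] by (simp add: mono_eval_def)
  ultimately obtain z where z: "homogeneous (Suc 0) z" "\<And>x. peval z x = x k"
    using homogeneous_coord_mult[of 0 "1 :: 'n cpoly" k] by auto
  from irreducible_forms[OF assms(1,2) z(1)] p k show ?thesis by (auto simp: z(2))
qed

lemma lin_form: "\<exists>p. homogeneous 1 p \<and> (\<forall>v. peval p (($) v) = lin a v)"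
proof (intro exI conjI allI)
  let ?p = "\<Sum>i\<in>UNIV. Poly_Mapping.single (Poly_Mapping.single i (1::nat)) (a $ i)"
  show "homogeneous 1 ?p"
    by (intro homogeneous_sum homogeneous_single) (simp add: lookup_single when_def)
  show "peval ?p (($) v) = lin a v" for v
    by (simp add: peval_sum peval_single lin_def mono_eval_def)
qed

lemma nondegenerate_lin:
  assumes "nondegenerate X" "X \<subseteq> proj_space" "\<forall>v\<in>affine_cone X. lin a v = 0"
  shows "a = 0"
proof (rule ccontr)
  assume "a \<noteq> 0"
  then have "proj_hyperplane {L \<in> proj_space. \<forall>v\<in>L. (\<Sum>i\<in>UNIV. a $ i * v $ i) = 0}"
    unfolding proj_hyperplane_def by blast
  moreover have "X \<subseteq> {L \<in> proj_space. \<forall>v\<in>L. (\<Sum>i\<in>UNIV. a $ i * v $ i) = 0}"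
    using assms(2,3) by (auto simp: affine_cone_def lin_def)
  ultimately show False using assms(1) unfolding nondegenerate_def by blast
qed

lemma nondegenerate_coordinate:
  assumes "nondegenerate X" "X \<subseteq> proj_space"
  shows "\<exists>v\<in>affine_cone X. v $ k \<noteq> 0"
proof (rule ccontr)
  assume "\<not> ?thesis"
  then have "\<forall>v\<in>affine_cone X. lin (axis k 1) v = 0"
    by (auto simp: lin_def axis_def if_distrib[of "\<lambda>x. x * _"] cong: if_cong)
  from nondegenerate_lin[OF assms this] show False by simp
qed

section \<open>The affine chart of a projective curve\<close>

definition affine_chart :: "'n \<Rightarrow> (complex ^ 'n) set set \<Rightarrow> (complex ^ 'n) set" where
  "affine_chart k X = {v \<in> affine_cone X. v $ k = 1}"

lemma chart_normalize:
  assumes "X \<subseteq> proj_space" "v \<in> affine_cone X" "v $ k \<noteq> 0"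
  shows "inverse (v $ k) *s v \<in> affine_chart k X"
  using assms by (simp add: affine_chart_def affine_cone_scale)

lemma affine_curve_chart:
  fixes X :: "(complex ^ 'n) set set" and k :: 'n
  assumes curve: "irreducible_proj_curve X" and nondeg: "nondegenerate X"
  shows "affine_curve (affine_chart k X)"
proof
  have irr: "irreducible_proj_variety X" and dim: "proj_dim X = 1"
    using curve by (auto simp: irreducible_proj_curve_def)
  note sub = irreducible_subset_proj_space[OF irr]
  note nz = nondegenerate_coordinate[OF nondeg sub, of k]
  note norm = chart_normalize[OF sub, where k = k]
  show "affine_chart k X \<noteq> {}" using nz norm by blast
  {
    fix f g :: "complex ^ 'n \<Rightarrow> complex"
    assume f: "polyf f" and g: "polyf g" and fg: "\<forall>v\<in>affine_chart k X. f v * g v = 0"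
    obtain d e where "pf UNIV d f" "pf UNIV e g" using f g by (auto simp: polyf_def)
    then obtain p q where
      p: "homogeneous d p" "\<forall>v. v $ k \<noteq> 0 \<longrightarrow> peval p (($) v) = (v $ k) ^ d * f (inverse (v $ k) *s v)" and
      q: "homogeneous e q" "\<forall>v. v $ k \<noteq> 0 \<longrightarrow> peval q (($) v) = (v $ k) ^ e * g (inverse (v $ k) *s v)"
      using homogenize by metis
    \<comment> \<open>The additional factor \<open>v $ k\<close> makes the product vanish at
      infinity too, where the hypothesis on the chart gives no information.\<close>
    from homogeneous_coord_mult[OF p(1), of k] obtain p' where
      p': "homogeneous (Suc d) p'" "\<And>x. peval p' x = x k * peval p x" by blast
    have "\<forall>v\<in>affine_cone X. peval p' (($) v) = 0 \<or> peval q (($) v) = 0"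
    proof
      fix v assume v: "v \<in> affine_cone X"
      show "peval p' (($) v) = 0 \<or> peval q (($) v) = 0"
      proof (cases "v $ k = 0")
        case False
        with fg norm[OF v] have "f (inverse (v $ k) *s v) * g (inverse (v $ k) *s v) = 0" by blast
        with False show ?thesis by (auto simp: p' p(2) q(2))
      qed (simp add: p')
    qed
    from irreducible_forms[OF irr p'(1) q(1) this]
    have "(\<forall>v\<in>affine_chart k X. peval p' (($) v) = 0) \<or> (\<forall>v\<in>affine_chart k X. peval q (($) v) = 0)"
      by (auto simp: affine_chart_def)
    then show "(\<forall>v\<in>affine_chart k X. f v = 0) \<or> (\<forall>v\<in>affine_chart k X. g v = 0)"
      by (auto simp: affine_chart_def p' p(2) q(2))
  }
  {
    fix f h g :: "complex ^ 'n \<Rightarrow> complex"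
    assume "polyf f" "polyf h" "polyf g" and g: "\<exists>v\<in>affine_chart k X. g v \<noteq> 0"
    then obtain d1 d2 d3 where "pf UNIV d1 f" "pf UNIV d2 h" "pf UNIV d3 g" by (auto simp: polyf_def)
    \<comment> \<open>Numerators and denominator must become forms of equal degree to define
      elements of the function field.\<close>
    then have "pf UNIV (d1 + d2 + d3) f" "pf UNIV (d1 + d2 + d3) h" "pf UNIV (d1 + d2 + d3) g"
      by (auto elim: pf_mono)
    from this[THEN homogenize[where k = k]] obtain p r q where
      p: "homogeneous (d1 + d2 + d3) p" "\<And>v. v $ k \<noteq> 0 \<Longrightarrow> peval p (($) v) = (v $ k) ^ (d1 + d2 + d3) * f (inverse (v $ k) *s v)" and
      r: "homogeneous (d1 + d2 + d3) r" "\<And>v. v $ k \<noteq> 0 \<Longrightarrow> peval r (($) v) = (v $ k) ^ (d1 + d2 + d3) * h (inverse (v $ k) *s v)" and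
      q: "homogeneous (d1 + d2 + d3) q" "\<And>v. v $ k \<noteq> 0 \<Longrightarrow> peval q (($) v) = (v $ k) ^ (d1 + d2 + d3) * g (inverse (v $ k) *s v)"
      by blast
    let ?F = "\<lambda>j::nat. if j = 0 then p else r"
    have "\<not> alg_indep_rational_functions X 2 ?F q"
    proof
      assume "alg_indep_rational_functions X 2 ?F q"
      then have "enat 2 \<le> proj_dim X" unfolding proj_dim_def by (intro Sup_upper) blast
      then show False by (simp add: dim one_enat_def)
    qed
    moreover have "\<exists>d. homogeneous d q \<and> (\<forall>j<2. homogeneous d (?F j))" using p(1) q(1) r(1) by auto
    moreover have "q \<notin> vanishing_ideal (affine_cone X)"
    proof -
      obtain v where "v \<in> affine_chart k X" "g v \<noteq> 0" using g by blast
      then show ?thesis by (auto simp: vanishing_ideal_def affine_chart_def q(2) intro!: bexI[of _ v])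
    qed
    ultimately obtain P where P: "P \<in> polys_in {..<2}" "P \<noteq> 0"
      "\<forall>v\<in>affine_cone X. peval q (($) v) \<noteq> 0 \<longrightarrow> peval P (\<lambda>j. peval (?F j) (($) v) / peval q (($) v)) = 0"
      unfolding alg_indep_rational_functions_def by blast
    from peval_bivariate[OF P(1,2)] obtain Q where Q: "Q \<noteq> 0" "\<And>x. peval P x = ev Q (x 0) (x 1)" by blast
    have "ev Q (f v / g v) (h v / g v) = 0" if v: "v \<in> affine_chart k X" "g v \<noteq> 0" for v
    proof -
      have v1: "v \<in> affine_cone X" "v $ k = 1" using v(1) by (auto simp: affine_chart_def)
      then have "peval p (($) v) = f v" "peval r (($) v) = h v" "peval q (($) v) = g v"
        by (simp_all add: p(2) r(2) q(2))
      with P(3) v1(1) v(2) show ?thesis by (auto simp: Q(2))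
    qed
    with Q(1) show "\<exists>P. P \<noteq> 0 \<and> (\<forall>v\<in>affine_chart k X. g v \<noteq> 0 \<longrightarrow> ev P (f v / g v) (h v / g v) = 0)"
      by blast
  }
  {
    fix a :: "complex ^ 'n" assume a: "\<forall>v\<in>affine_chart k X. lin a v = 0"
    obtain p where p: "homogeneous 1 p" "\<And>v. peval p (($) v) = lin a v" using lin_form by blast
    have "\<forall>v\<in>affine_cone X. v $ k \<noteq> 0 \<longrightarrow> peval p (($) v) = 0"
    proof (intro ballI impI)
      fix v assume v: "v \<in> affine_cone X" "v $ k \<noteq> 0"
      have "peval p (($) (inverse (v $ k) *s v)) = 0" using a norm[OF v] by (simp add: p(2))
      then show "peval p (($) v) = 0" using v(2) by (simp add: peval_homogeneous[OF p(1)])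
    qed
    from form_times_coordinate[OF irr p(1) nz this] show "a = 0"
      using nondegenerate_lin[OF nondeg sub] by (simp add: p(2))
  }
qed

text \<open>For fixed \<open>y\<close>, \<open>f (t *s y)\<close> is a polynomial in
  \<open>t\<close> whose coefficients are the homogeneous components of \<open>f\<close> at
  \<open>y\<close>. Each component therefore vanishes on the chart, and then on the whole cone,
  including its points with \<open>v $ k = 0\<close>.\<close>

lemma chart_dense:
  assumes irr: "irreducible_proj_variety X" and nz: "\<exists>v\<in>affine_cone X. v $ k \<noteq> 0"
    and f: "polyf f" and zero: "\<And>t y. y \<in> affine_chart k X \<Longrightarrow> f (t *s y) = 0" and v: "v \<in> affine_cone X"
  shows "f v = 0"
proof -
  note sub = irreducible_subset_proj_space[OF irr]
  obtain d where "pf UNIV d f" using f by (auto simp: polyf_def)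
  from homogeneous_components[OF this] obtain p where
    p: "\<And>j. homogeneous j (p j)" "\<And>v. f v = (\<Sum>j\<le>d. peval (p j) (($) v))" by blast
  have chart: "peval (p j) (($) y) = 0" if y: "y \<in> affine_chart k X" and j: "j \<le> d" for y j
  proof -
    define c where "c = (\<Sum>j\<le>d. monom (peval (p j) (($) y)) j)"
    have "poly c t = f (t *s y)" for t
      by (simp add: c_def poly_sum poly_monom p(2) peval_homogeneous[OF p(1)] mult.commute)
    with zero[OF y] have "c = 0" by (simp add: poly_eq_poly_eq_iff[symmetric] fun_eq_iff)
    moreover have "coeff c j = peval (p j) (($) y)" unfolding c_def coeff_sum using j by (simp add: coeff_monom)
    ultimately show ?thesis by simp
  qed
  have "peval (p j) (($) v) = 0" if j: "j \<le> d" for j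
  proof -
    have "\<forall>v\<in>affine_cone X. v $ k \<noteq> 0 \<longrightarrow> peval (p j) (($) v) = 0"
    proof (intro ballI impI)
      fix v assume v: "v \<in> affine_cone X" "v $ k \<noteq> 0"
      have "peval (p j) (($) (inverse (v $ k) *s v)) = 0" by (rule chart[OF chart_normalize[OF sub v] j])
      then show "peval (p j) (($) v) = 0" using v(2) by (simp add: peval_homogeneous[OF p(1)])
    qed
    from form_times_coordinate[OF irr p(1) nz this] v show ?thesis by blast
  qed
  then show ?thesis by (simp add: p(2))
qed

section \<open>From the chart to secant varieties and their matroids\<close>

definition sumset :: "nat \<Rightarrow> (complex ^ 'n) set \<Rightarrow> (complex ^ 'n) set" where
  "sumset s C = {(\<Sum>i<s. x i) | x :: nat \<Rightarrow> complex ^ 'n. \<forall>i<s. x i \<in> C}"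

lemma sumset_1: "sumset 1 C = C"
  by (auto simp: sumset_def intro: exI[of _ "\<lambda>_. _"])

lemma vanishing_on_sumset:
  assumes irr: "irreducible_proj_variety X" and nz: "\<exists>v\<in>affine_cone X. v $ k \<noteq> 0" and f: "polyf f"
  shows "(\<forall>v\<in>sumset s (affine_cone X). f v = 0) \<longleftrightarrow>
    (\<forall>x. (\<forall>i<s. snd (x i) \<in> affine_chart k X) \<longrightarrow> f (\<Sum>i<s. fst (x i) *s snd (x i)) = 0)"
    (is "?L \<longleftrightarrow> ?R")
proof
  assume L: ?L
  show ?R
  proof (intro allI impI)
    fix x :: "nat \<Rightarrow> complex \<times> (complex ^ 'a)" assume "\<forall>i<s. snd (x i) \<in> affine_chart k X"
    then have "\<forall>i<s. fst (x i) *s snd (x i) \<in> affine_cone X"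
      using affine_cone_scale[OF irreducible_subset_proj_space[OF irr]] by (auto simp: affine_chart_def)
    then have "(\<Sum>i<s. fst (x i) *s snd (x i)) \<in> sumset s (affine_cone X)"
      unfolding sumset_def by (intro CollectI exI[of _ "\<lambda>i. fst (x i) *s snd (x i)"]) simp
    with L show "f (\<Sum>i<s. fst (x i) *s snd (x i)) = 0" by blast
  qed
next
  assume R: ?R
  \<comment> \<open>Summands are freed one at a time: the first \<open>m\<close> range over the
    cone, the others are still multiples of chart points, and \<open>chart_dense\<close> is applied
    in a single summand.\<close>
  have partial: "m \<le> s \<Longrightarrow> \<forall>i<m. u i \<in> affine_cone X \<Longrightarrow> \<forall>i<s. snd (x i) \<in> affine_chart k X \<Longrightarrow>
      f ((\<Sum>i<m. u i) + (\<Sum>i\<in>{m..<s}. fst (x i) *s snd (x i))) = 0" for m u x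
  proof (induction m arbitrary: x)
    case 0
    then show ?case using R by (simp add: atLeast0LessThan)
  next
    case (Suc m)
    let ?F = "\<lambda>v. f ((\<Sum>i<m. u i) + v + (\<Sum>i\<in>{Suc m..<s}. fst (x i) *s snd (x i)))"
    have "?F (t *s y) = 0" if y: "y \<in> affine_chart k X" for t y
    proof -
      have "f ((\<Sum>i<m. u i) + (\<Sum>i\<in>{m..<s}. fst ((x(m := (t, y))) i) *s snd ((x(m := (t, y))) i))) = 0"
        using Suc.prems y by (intro Suc.IH) auto
      moreover have "(\<Sum>i\<in>{m..<s}. fst ((x(m := (t, y))) i) *s snd ((x(m := (t, y))) i)) =
          t *s y + (\<Sum>i\<in>{Suc m..<s}. fst (x i) *s snd (x i))"
        using Suc.prems(1) by (simp add: sum.atLeast_Suc_lessThan)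
      ultimately show ?thesis by (simp add: add.assoc)
    qed
    moreover have "polyf ?F" by (rule polyf_compose[OF f]) (simp add: polyf_add)
    moreover have "u m \<in> affine_cone X" using Suc.prems(2) by simp
    ultimately have "?F (u m) = 0" using chart_dense[OF irr nz] by blast
    then show ?case by simp
  qed
  show ?L
  proof
    fix v assume "v \<in> sumset s (affine_cone X)"
    then obtain u where u: "v = (\<Sum>i<s. u i)" "\<forall>i<s. u i \<in> affine_cone X" by (auto simp: sumset_def)
    obtain y where "y \<in> affine_chart k X"
      using nz chart_normalize[OF irreducible_subset_proj_space[OF irr]] by blast
    then show "f v = 0" using partial[of s u "\<lambda>_. (0, y)"] u by simp
  qed
qed

lemma alg_matroid_sumset:
  fixes X :: "(complex ^ 'n) set set"
  assumes curve: "irreducible_proj_curve X" and nondeg: "nondegenerate X" and "s \<ge> 1"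
  shows "alg_matroid (sumset s (affine_cone X)) = {E. card E \<le> 2 * s}"
proof -
  have irr: "irreducible_proj_variety X" using curve by (simp add: irreducible_proj_curve_def)
  \<comment> \<open>Any chart will do: by nondegeneracy no coordinate vanishes identically on the
    cone.\<close>
  define k :: 'n where "k = undefined"
  note nz = nondegenerate_coordinate[OF nondeg irreducible_subset_proj_space[OF irr], of k]
  interpret affine_curve "affine_chart k X" by (rule affine_curve_chart[OF curve nondeg])
  have pf: "\<exists>d. pf E d (\<lambda>v. peval p (($) v))" if "p \<in> polys_in E" for E p
    using pf_peval[OF that] .
  have van: "p \<in> vanishing_ideal (sumset s (affine_cone X)) \<longleftrightarrow>
    (\<forall>x. (\<forall>i<s. snd (x i) \<in> affine_chart k X) \<longrightarrow> peval p (($) (tuple_sum s x)) = 0)" for p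
  proof -
    have "p \<in> polys_in UNIV" by (simp add: polys_in_def)
    from pf[OF this] have "polyf (\<lambda>v. peval p (($) v))" unfolding polyf_def .
    from vanishing_on_sumset[OF irr nz this, of s] show ?thesis
      unfolding vanishing_ideal_def tuple_sum_def mem_Collect_eq .
  qed
  have zero: "0 \<in> vanishing_ideal (sumset s (affine_cone X)) \<inter> polys_in E" for E
    by (simp add: vanishing_ideal_def polys_in_def)
  show ?thesis
  proof (intro equalityI subsetI)
    fix E assume E: "E \<in> alg_matroid (sumset s (affine_cone X))"
    show "E \<in> {E. card E \<le> 2 * s}"
    proof (rule ccontr)
      assume "E \<notin> {E. card E \<le> 2 * s}"
      then have "card E > 2 * s" by simp
      from dependent_sums[OF this assms(3)] obtain p where
        "p \<in> polys_in E" "p \<noteq> 0" "p \<in> vanishing_ideal (sumset s (affine_cone X))"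
        unfolding van by blast
      with E show False by (auto simp: alg_matroid_def)
    qed
  next
    fix E :: "'n set" assume "E \<in> {E. card E \<le> 2 * s}"
    then have E: "card E \<le> 2 * s" by simp
    have "p = 0" if p: "p \<in> vanishing_ideal (sumset s (affine_cone X))" "p \<in> polys_in E" for p
    proof -
      obtain d where "pf E d (\<lambda>v. peval p (($) v))" using pf[OF p(2)] ..
      from independent_sums[OF E this] p(1) have "peval p (($) v) = 0" for v
        unfolding van by blast
      then show ?thesis by (rule peval_eq_0_imp)
    qed
    with zero show "E \<in> alg_matroid (sumset s (affine_cone X))"
      unfolding alg_matroid_def by blast
  qed
qed

text \<open>The zero set of a single polynomial is closed, so it contains the hull as soon as it
  contains \<open>S\<close>.\<close>

lemma vanishing_ideal_hull: "vanishing_ideal (zariski_closed hull S) = vanishing_ideal S"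
proof (intro equalityI subsetI)
  fix p assume "p \<in> vanishing_ideal (zariski_closed hull S)"
  then show "p \<in> vanishing_ideal S" using hull_subset[of S zariski_closed] by (auto simp: vanishing_ideal_def)
next
  fix p assume p: "p \<in> vanishing_ideal S"
  have "zariski_closed {y. \<forall>p\<in>{p}. peval p (($) y) = 0}" unfolding zariski_closed_def by blast
  moreover have "S \<subseteq> {y. \<forall>p\<in>{p}. peval p (($) y) = 0}" using p by (auto simp: vanishing_ideal_def)
  ultimately have "zariski_closed hull S \<subseteq> {y. \<forall>p\<in>{p}. peval p (($) y) = 0}" by (rule hull_minimal[rotated])
  then show "p \<in> vanishing_ideal (zariski_closed hull S)" by (auto simp: vanishing_ideal_def)
qed

lemma matroid_union_power_uniform:
  "matroid_union_power s {E :: 'a::finite set. card E \<le> r} = {E. card E \<le> r * s}"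
proof (intro equalityI subsetI)
  fix E :: "'a set" assume "E \<in> matroid_union_power s {E. card E \<le> r}"
  then obtain I where I: "E = (\<Union>i<s. I i)" "\<forall>i<s. card (I i) \<le> r"
    unfolding matroid_union_power_def mem_Collect_eq by (elim exE conjE)
  have "card E \<le> (\<Sum>i<s. card (I i))" unfolding I(1) by (rule card_UN_le) simp
  also have "\<dots> \<le> r * s" using sum_bounded_above[of "{..<s}" "\<lambda>i. card (I i)" r] I(2) by (simp add: mult.commute)
  finally show "E \<in> {E. card E \<le> r * s}" by simp
next
  fix E :: "'a set" assume "E \<in> {E. card E \<le> r * s}"
  then have "\<exists>I. E = (\<Union>i<s. I i) \<and> (\<forall>i<s. card (I i) \<le> r)"
  proof (induction s arbitrary: E)
    case (Suc s)
    \<comment> \<open>A greedy split: one block takes as many elements as allowed, and at most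
      \<open>r * s\<close> remain for the other \<open>s\<close> blocks.\<close>
    have "min r (card E) \<le> card E" by simp
    from obtain_subset_with_card_n[OF this] obtain F where F: "F \<subseteq> E" "card F = min r (card E)" by blast
    have "card (E - F) = card E - card F" using F(1) by (simp add: card_Diff_subset)
    then have "E - F \<in> {E. card E \<le> r * s}" using Suc.prems F(2) by (auto simp: min_def split: if_splits)
    from Suc.IH[OF this] obtain I where I: "E - F = (\<Union>i<s. I i)" "\<forall>i<s. card (I i) \<le> r"
      by (elim exE conjE)
    have "(\<Union>i<s. (I(s := F)) i) = (\<Union>i<s. I i)" by (intro SUP_cong) auto
    then have "(\<Union>i<Suc s. (I(s := F)) i) = F \<union> (\<Union>i<s. I i)"
      unfolding lessThan_Suc UN_insert by simp
    also have "\<dots> = E" unfolding I(1)[symmetric] using F(1) by blast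
    finally have "E = (\<Union>i<Suc s. (I(s := F)) i)" ..
    moreover have "\<forall>i<Suc s. card ((I(s := F)) i) \<le> r" using I(2) F(2) by (simp add: less_Suc_eq)
    ultimately show ?case by (intro exI[of _ "I(s := F)"] conjI)
  qed simp
  then show "E \<in> matroid_union_power s {E. card E \<le> r}"
    unfolding matroid_union_power_def mem_Collect_eq .
qed

theorem theorem4p1:
  fixes X :: "(complex ^ 'n) set set" and s :: nat
  assumes "irreducible_proj_curve X"
    and "nondegenerate X"
    and "s \<ge> 1"
  shows "alg_matroid (secant_variety s (affine_cone X))
           = matroid_union_power s (alg_matroid (affine_cone X)) \<and>
         alg_matroid (secant_variety s (affine_cone X))
           = uniform_matroid (min (2 * s) CARD('n))"
proof -
  have "alg_matroid (secant_variety s (affine_cone X)) = alg_matroid (sumset s (affine_cone X))"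
    by (simp add: alg_matroid_def secant_variety_def sumset_def vanishing_ideal_hull)
  also have "\<dots> = {E. card E \<le> 2 * s}" by (rule alg_matroid_sumset[OF assms])
  finally have secant: "alg_matroid (secant_variety s (affine_cone X)) = {E. card E \<le> 2 * s}" .
  have "alg_matroid (affine_cone X) = {E. card E \<le> 2}"
    using alg_matroid_sumset[OF assms(1,2), of 1] unfolding sumset_1 by simp
  then have "matroid_union_power s (alg_matroid (affine_cone X)) = {E. card E \<le> 2 * s}"
    by (simp add: matroid_union_power_uniform)
  moreover have "uniform_matroid (min (2 * s) CARD('n)) = {E :: 'n set. card E \<le> 2 * s}"
    by (auto simp: uniform_matroid_def intro: card_mono)
  ultimately show ?thesis using secant by simp
qed

end
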